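(* Let $\alpha=\alpha(n)=n/\log^4 n$, and let $\mathcal{I}_n(\alpha)$ denote the family of all $\alpha$-generalized Sidon sets $I\subseteq[n]$ satisfying $|I|\leq \sqrt{n}/\log n$ or $|I|\geq \sqrt{n}/\sqrt{\log n}$. Then for all sufficiently large $n$, $$|\mathcal{I}_n(\alpha)|\leq 2^{180\sqrt{n}}.$$
   Context: All logarithms are to base 2, and $[n]=\{1,\dots,n\}$. A Sidon 4-tuple in a set $A$ of nonnegative integers is an (ordered) 4-tuple $(a,b,c,d)$ of elements of $A$ with $a+b=c+d$ and $\{a,b\}\cap\{c,d\}=\emptyset$. For $\alpha\geq 0$, an $\alpha$-generalized Sidon set in $[n]$ is a set $I\subseteq[n]$ containing at most $\alpha$ Sidon 4-tuples. *)

theory Defs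
  imports Complex_Main
begin

definition sidon_tuples :: "nat set \<Rightarrow> (nat \<times> nat \<times> nat \<times> nat) set" where
  "sidon_tuples A = {(a, b, c, d). a \<in> A \<and> b \<in> A \<and> c \<in> A \<and> d \<in> A \<and>
     a + b = c + d \<and> {a, b} \<inter> {c, d} = {}}"

(* As I is contained in {1..n}, the set of tuples is finite and card counts it. *)
definition generalized_sidon :: "real \<Rightarrow> nat \<Rightarrow> nat set \<Rightarrow> bool" where
  "generalized_sidon \<alpha> n I \<longleftrightarrow> I \<subseteq> {1..n} \<and> real (card (sidon_tuples I)) \<le> \<alpha>"

definition sidon_family :: "nat \<Rightarrow> real \<Rightarrow> nat set set" where
  "sidon_family n \<alpha> = {I. generalized_sidon \<alpha> n I \<and>
     (real (card I) \<le> sqrt (real n) / log 2 (real n) \<or>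
      real (card I) \<ge> sqrt (real n) / sqrt (log 2 (real n)))}"

end

theory Submission
  imports Defs "HOL-Analysis.Analysis" "HOL-Real_Asymp.Real_Asymp"
begin

text \<open>
  Write \<open>L = log 2 n\<close>. The few sets with at most \<open>\<surd>n / L\<close> elements are counted trivially. For a large set
  \<open>I\<close>, averaging gives a seed \<open>S \<subseteq> I\<close> of prescribed size \<open>s\<close> such that few Sidon 4-tuples
  \<open>x + a = y + b\<close> of \<open>I\<close> have \<open>a, b \<in> S\<close>. In the multigraph joining \<open>x\<close> and \<open>y\<close> once for each such
  \<open>(a, b) \<in> S \<times> S\<close>, the set \<open>I - S\<close> spans few edges, while by Cauchy-Schwarz every set of more than
  \<open>4 n / s\<close> vertices spans many. The Kleitman-Winston algorithm therefore encloses \<open>I\<close> in one of few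
  containers of size at most \<open>6 n / s\<close>. Since \<open>I\<close> is only sparse and not independent, removing the
  neighbourhood of a vertex of \<open>I\<close> may lose elements of \<open>I\<close>; these are recorded separately, and the
  assumptions on \<open>\<alpha>\<close> and \<open>|I|\<close> keep their number \<open>O(\<surd>n / L)\<close>.

  The first seed, of size \<open>\<surd>n / L\<close>, is chosen from \<open>{1..n}\<close>; each further seed is twice as large but is
  chosen from the previous container, so that the choices cost \<open>O(\<surd>(s \<surd>n))\<close> bits each, a geometric sum
  dominated by its last term \<open>O(\<surd>n)\<close>.
\<close>

subsection \<open>Counting and averaging\<close>

text \<open>Such a set arises from \<open>k\<close> successive choices, each adding one element of
  \<open>X\<close> or nothing.\<close>

lemma card_subsets_card_le:
  assumes "finite X"
  shows "card {T. T \<subseteq> X \<and> card T \<le> k} \<le> (card X + 1) ^ k"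
proof (induction k)
  case 0
  have "{T. T \<subseteq> X \<and> card T \<le> 0} \<subseteq> {{}}"
    using assms finite_subset by fastforce
  then show ?case
    using card_mono[of "{{}}" "{T. T \<subseteq> X \<and> card T \<le> 0}"] by simp
next
  case (Suc k)
  let ?F = "\<lambda>k. {T. T \<subseteq> X \<and> card T \<le> k}"
  let ?g = "\<lambda>(x, T). case x of None \<Rightarrow> T | Some y \<Rightarrow> insert y T"
  let ?P = "insert None (Some ` X) \<times> ?F k"
  have "?F (Suc k) \<subseteq> ?g ` ?P"
  proof
    fix T assume T: "T \<in> ?F (Suc k)"
    show "T \<in> ?g ` ?P"
    proof (cases "card T \<le> k")
      case True
      then have "T = ?g (None, T)" "(None, T) \<in> ?P" using T by auto
      then show ?thesis by blast
    next
      case False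
      then obtain y where y: "y \<in> T" using T by fastforce
      have "finite T" using T assms finite_subset by blast
      then have "T = ?g (Some y, T - {y})" "(Some y, T - {y}) \<in> ?P"
        using T y by (auto simp: card_Diff_singleton)
      then show ?thesis by blast
    qed
  qed
  moreover have fin: "finite ?P" using assms by auto
  ultimately have "card (?F (Suc k)) \<le> card ?P"
    by (rule surj_card_le[rotated])
  also have "\<dots> = (card X + 1) * card (?F k)"
    using assms by (simp add: card_cartesian_product card_image)
  also have "\<dots> \<le> (card X + 1) * (card X + 1) ^ k"
    using Suc.IH mult_le_mono2 by blast
  finally show ?case by simp
qed

text \<open>Combining k! (N choose k) \<le> N^k with (k!)^3 \<le> k^(3k) bounds the binomial
  coefficient by (y^k / k!)^4, whose base is a term of the series of exp y. This suits
  \<open>k\<close> of order s and \<open>N\<close> of order n / s: then \<open>y\<close> has order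
  sqrt (s sqrt n), and no logarithm is lost.\<close>

lemma binomial_le_exp:
  fixes y :: real
  assumes "0 \<le> y" "real k ^ 3 * real N \<le> y ^ 4"
  shows "real (N choose k) \<le> exp (4 * y)"
proof -
  have fact_le: "real (fact k) \<le> real k ^ k"
    using fact_le_power[of k, where ?'a = real] by simp
  have *: "real (N choose k) * fact k ^ 4 \<le> (y ^ k) ^ 4"
  proof -
    have "fact k * (N choose k) \<le> N ^ k" using binomial_fact_pow[of N k] by (simp add: mult.commute)
    then have "real (N choose k) * fact k \<le> real N ^ k"
      by (metis mult.commute of_nat_fact of_nat_le_iff of_nat_mult of_nat_power)
    moreover have "fact k ^ 3 \<le> (real k ^ k) ^ 3"
      using fact_le by (intro power_mono) auto
    ultimately have "real (N choose k) * fact k * fact k ^ 3 \<le> real N ^ k * (real k ^ k) ^ 3"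
      by (intro mult_mono) auto
    also have "\<dots> = (real k ^ 3 * real N) ^ k"
      by (simp add: power_mult_distrib power_mult[symmetric] mult.commute)
    also have "\<dots> \<le> (y ^ 4) ^ k" using assms by (intro power_mono) auto
    also have "\<dots> = (y ^ k) ^ 4" by (simp add: power_mult[symmetric] mult.commute)
    finally show ?thesis by (simp add: eval_nat_numeral mult.assoc)
  qed
  have "y ^ k / fact k \<le> exp y"
  proof -
    have "(\<Sum>i\<in>{k}. y ^ i /\<^sub>R fact i) \<le> (\<Sum>i. y ^ i /\<^sub>R fact i)"
      by (rule sum_le_suminf[OF summable_exp_generic]) (simp_all add: assms(1))
    then have "(\<Sum>i\<in>{k}. y ^ i /\<^sub>R fact i) \<le> exp y" unfolding exp_def .
    then show ?thesis by (simp add: divide_inverse mult.commute)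
  qed
  then have "(y ^ k / fact k) ^ 4 \<le> exp y ^ 4"
    using assms(1) by (intro power_mono) auto
  moreover have "real (N choose k) \<le> (y ^ k / fact k) ^ 4"
    using * by (simp add: power_divide field_simps)
  ultimately show ?thesis by (simp add: exp_of_nat_mult[symmetric])
qed

text \<open>Delete elements of \<open>I\<close> one at a time. By averaging, the step from k + 1 to
  k elements can be made so that at most a fraction (k - 1) / (k + 1) \<le> k^2 / (k + 1)^2 of the
  pairs survives, and these fractions telescope.\<close>

lemma ex_subset_few_pairs:
  fixes a b :: "'q \<Rightarrow> 'a"
  assumes I: "finite I" and Q: "finite Q" and ab: "\<And>q. q \<in> Q \<Longrightarrow> a q \<noteq> b q"
    and s: "s \<le> card I"
  shows "\<exists>S\<subseteq>I. card S = s \<and>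
    card {q \<in> Q. a q \<in> S \<and> b q \<in> S} * (card I)\<^sup>2 \<le> card Q * s\<^sup>2"
  using s
proof (induction rule: inc_induct)
  case base
  have "card {q \<in> Q. a q \<in> I \<and> b q \<in> I} \<le> card Q" using Q by (intro card_mono) auto
  then show ?case by (intro exI[of _ I]) auto
next
  case (step k)
  then obtain S where S: "S \<subseteq> I" "card S = Suc k"
    and le: "card {q \<in> Q. a q \<in> S \<and> b q \<in> S} * (card I)\<^sup>2 \<le> card Q * (Suc k)\<^sup>2" by blast
  let ?E = "\<lambda>S. {q \<in> Q. a q \<in> S \<and> b q \<in> S}"
  have fS: "finite S" using S I finite_subset by blast
  have "(\<Sum>v\<in>S. card (?E (S - {v}))) = (\<Sum>v\<in>S. \<Sum>q\<in>?E S. if v \<noteq> a q \<and> v \<noteq> b q then 1 else 0)"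
  proof (rule sum.cong[OF refl])
    fix v assume "v \<in> S"
    have "(\<Sum>q\<in>?E S. if v \<noteq> a q \<and> v \<noteq> b q then 1 else 0) = card {q \<in> ?E S. v \<noteq> a q \<and> v \<noteq> b q}"
      using Q by (simp add: sum.If_cases Int_def)
    also have "{q \<in> ?E S. v \<noteq> a q \<and> v \<noteq> b q} = ?E (S - {v})" by auto
    finally show "card (?E (S - {v})) = (\<Sum>q\<in>?E S. if v \<noteq> a q \<and> v \<noteq> b q then 1 else 0)" by simp
  qed
  also have "\<dots> = (\<Sum>q\<in>?E S. \<Sum>v\<in>S. if v \<noteq> a q \<and> v \<noteq> b q then 1 else 0)" by (rule sum.swap)
  \<comment> \<open>The endpoints of \<open>q\<close> are distinct, so \<open>k - 1\<close> of the
    \<open>k + 1\<close> possible deletions keep both.\<close>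
  also have "\<dots> = (\<Sum>q\<in>?E S. k - 1)"
  proof (rule sum.cong[OF refl])
    fix q assume q: "q \<in> ?E S"
    have "(\<Sum>v\<in>S. if v \<noteq> a q \<and> v \<noteq> b q then 1 else 0) = card {v \<in> S. v \<noteq> a q \<and> v \<noteq> b q}"
      using fS by (simp add: sum.If_cases Int_def)
    also have "{v \<in> S. v \<noteq> a q \<and> v \<noteq> b q} = S - {a q, b q}" by auto
    also have "card \<dots> = k - 1" using q ab[of q] fS S by (subst card_Diff_subset) auto
    finally show "(\<Sum>v\<in>S. if v \<noteq> a q \<and> v \<noteq> b q then 1 else 0) = k - 1" .
  qed
  finally have sum: "(\<Sum>v\<in>S. card (?E (S - {v}))) = card (?E S) * (k - 1)" by simp
  have "\<exists>v\<in>S. Suc k * card (?E (S - {v})) \<le> card (?E S) * (k - 1)"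
  proof (rule ccontr)
    assume "\<not> ?thesis"
    then have "card (?E S) * (k - 1) < Suc k * card (?E (S - {v}))" if "v \<in> S" for v
      using that by (meson not_le)
    moreover have "S \<noteq> {}" using S by auto
    ultimately have "(\<Sum>v\<in>S. card (?E S) * (k - 1)) < (\<Sum>v\<in>S. Suc k * card (?E (S - {v})))"
      using fS by (intro sum_strict_mono) auto
    then show False using sum S by (simp only: sum_distrib_left[symmetric] sum_constant) (simp add: algebra_simps)
  qed
  then obtain v where v: "v \<in> S" "Suc k * card (?E (S - {v})) \<le> card (?E S) * (k - 1)" by blast
  have "(Suc k)\<^sup>2 * (card (?E (S - {v})) * (card I)\<^sup>2) = Suc k * (Suc k * card (?E (S - {v}))) * (card I)\<^sup>2"
    by (simp add: power2_eq_square algebra_simps)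
  also have "\<dots> \<le> Suc k * (card (?E S) * (k - 1)) * (card I)\<^sup>2"
    by (rule mult_le_mono[OF mult_le_mono[OF order_refl v(2)] order_refl])
  also have "\<dots> = Suc k * (k - 1) * (card (?E S) * (card I)\<^sup>2)" by (simp add: algebra_simps)
  also have "\<dots> \<le> k\<^sup>2 * (card Q * (Suc k)\<^sup>2)"
  proof (rule mult_le_mono[OF _ le])
    show "Suc k * (k - 1) \<le> k\<^sup>2" by (cases k) (auto simp: power2_eq_square)
  qed
  finally have "(Suc k)\<^sup>2 * (card (?E (S - {v})) * (card I)\<^sup>2) \<le> (Suc k)\<^sup>2 * (card Q * k\<^sup>2)"
    by (simp add: algebra_simps)
  then have "card (?E (S - {v})) * (card I)\<^sup>2 \<le> card Q * k\<^sup>2"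
    by (subst (asm) mult_le_cancel1) simp
  moreover have "card (S - {v}) = k" using v S fS by simp
  ultimately show ?case using S(1) by (intro exI[of _ "S - {v}"]) auto
qed

text \<open>
  A level \<open>t\<close> at which few elements of \<open>B\<close> are lost per element of \<open>A\<close> removed, found by comparing the two
  sides after summing over all levels. It makes up for the lack of a bound on edge multiplicities.
\<close>

lemma ex_threshold:
  fixes w :: "'a \<Rightarrow> nat" and D :: real
  assumes "finite A" "B \<subseteq> A" and D: "real (\<Sum>v\<in>B. w v) \<le> D"
    and W: "0 < (\<Sum>v\<in>A. min (w v) k)"
  shows "\<exists>t\<in>{1..k}. (1 + real (card {v \<in> B. t \<le> w v})) * real (\<Sum>v\<in>A. min (w v) k)
    \<le> (real k + D) * real (card {v \<in> A. t \<le> w v})"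
proof (rule ccontr)
  assume neg: "\<not> ?thesis"
  let ?W = "real (\<Sum>v\<in>A. min (w v) k)"
  have fB: "finite B" using assms finite_subset by blast
  \<comment> \<open>Layer-cake summation: \<open>v\<close> is counted at exactly
    \<open>min (w v) k\<close> of the levels.\<close>
  have layer: "(\<Sum>t\<in>{1..k}. card {v \<in> X. t \<le> w v}) = (\<Sum>v\<in>X. min (w v) k)" if "finite X" for X
  proof -
    have "(\<Sum>t\<in>{1..k}. card {v \<in> X. t \<le> w v}) = (\<Sum>t\<in>{1..k}. \<Sum>v\<in>X. if t \<le> w v then 1 else 0)"
      using that by (simp add: sum.If_cases Int_def)
    also have "\<dots> = (\<Sum>v\<in>X. \<Sum>t\<in>{1..k}. if t \<le> w v then 1 else 0)" by (rule sum.swap)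
    also have "\<dots> = (\<Sum>v\<in>X. min (w v) k)"
    proof (rule sum.cong[OF refl])
      fix v
      have "{1..k} \<inter> {t. t \<le> w v} = {1..min (w v) k}" by auto
      then show "(\<Sum>t\<in>{1..k}. if t \<le> w v then 1 else 0) = min (w v) k"
        by (simp add: sum.If_cases)
    qed
    finally show ?thesis .
  qed
  have "{1..k} \<noteq> {}" using W by (cases k) auto
  then have "(\<Sum>t\<in>{1..k}. (real k + D) * real (card {v \<in> A. t \<le> w v}))
      < (\<Sum>t\<in>{1..k}. (1 + real (card {v \<in> B. t \<le> w v})) * ?W)"
    using neg by (intro sum_strict_mono) (auto simp: not_le)
  then have "(real k + D) * real (\<Sum>t\<in>{1..k}. card {v \<in> A. t \<le> w v})
      < (real k + real (\<Sum>t\<in>{1..k}. card {v \<in> B. t \<le> w v})) * ?W"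
    by (simp add: sum_distrib_left[symmetric] sum_distrib_right[symmetric] sum.distrib)
  then have "(real k + D) * ?W < (real k + real (\<Sum>v\<in>B. min (w v) k)) * ?W"
    unfolding layer[OF \<open>finite A\<close>] layer[OF fB] .
  moreover have "(\<Sum>v\<in>B. min (w v) k) \<le> (\<Sum>v\<in>B. w v)" by (intro sum_mono) auto
  then have "real k + real (\<Sum>v\<in>B. min (w v) k) \<le> real k + D" using D by linarith
  then have "(real k + real (\<Sum>v\<in>B. min (w v) k)) * ?W \<le> (real k + D) * ?W"
    by (rule mult_right_mono) (rule of_nat_0_le_iff)
  ultimately show False by linarith
qed

subsection \<open>Containers for sets spanning few edges\<close>

text \<open>
  The Kleitman-Winston algorithm. The label of \<open>(u, t) \<in> T\<close> says that the vertices \<open>v\<close> with \<open>t \<le> w u v\<close>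
  were removed after \<open>u\<close> was selected, and \<open>L\<close> collects the elements of \<open>J\<close> lost in this way.
\<close>

lemma weighted_containers:
  fixes w :: "'a \<Rightarrow> 'a \<Rightarrow> nat" and k :: nat and D \<delta> R :: real
  assumes "finite U" and \<delta>: "0 < \<delta>" and R: "0 < R" and D: "0 \<le> D"
    and dense: "\<And>V. V \<subseteq> U \<Longrightarrow> R < real (card V) \<Longrightarrow>
      \<exists>u\<in>V. \<delta> * real (card V) \<le> real (\<Sum>v\<in>V - {u}. min (w u v) k)"
  shows "\<exists>f. \<forall>J\<subseteq>U. (\<forall>u\<in>J. real (\<Sum>v\<in>J - {u}. w u v) \<le> D) \<longrightarrow>
    (\<exists>T L. T \<subseteq> U \<times> {1..k} \<and> L \<subseteq> U \<and>
      real (card T + card L) \<le>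
        (if real (card U) \<le> R then 0 else (real k + D) / \<delta> * (1 + ln (real (card U) / R))) \<and>
      f T \<subseteq> U \<and> real (card (f T)) \<le> R \<and> J \<subseteq> f T \<union> fst ` T \<union> L)"
  using assms(1) dense
proof (induction "card U" arbitrary: U rule: less_induct)
  case less
  define G where "G x = (if x \<le> R then 0 else (real k + D) / \<delta> * (1 + ln (x / R)))" for x
  define good where "good J \<longleftrightarrow> (\<forall>u\<in>J. real (\<Sum>v\<in>J - {u}. w u v) \<le> D)" for J
  define P where "P U f J \<longleftrightarrow> (\<exists>T L. T \<subseteq> U \<times> {1..k} \<and> L \<subseteq> U \<and>
      real (card T + card L) \<le> G (real (card U)) \<and>
      f T \<subseteq> U \<and> real (card (f T)) \<le> R \<and> J \<subseteq> f T \<union> fst ` T \<union> L)"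
    for U and f :: "('a \<times> nat) set \<Rightarrow> 'a set" and J
  have IH: "\<exists>f. \<forall>J\<subseteq>V. good J \<longrightarrow> P V f J" if "V \<subset> U" for V
    unfolding P_def good_def G_def
  proof (rule less.hyps)
    show "card V < card U" using that less.prems(1) by (rule psubset_card_mono[rotated])
    show "finite V" using that less.prems(1) finite_subset by blast
    show "\<exists>u\<in>V'. \<delta> * real (card V') \<le> real (\<Sum>v\<in>V' - {u}. min (w u v) k)"
      if "V' \<subseteq> V" "R < real (card V')" for V'
      using less.prems(2)[of V'] that \<open>V \<subset> U\<close> by blast
  qed
  have good_mono: "good J'" if "good J" "J' \<subseteq> J" "finite J" for J J'
    unfolding good_def
  proof
    fix u assume u: "u \<in> J'"
    have "(\<Sum>v\<in>J' - {u}. w u v) \<le> (\<Sum>v\<in>J - {u}. w u v)"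
      using that by (intro sum_mono2) auto
    also have "real \<dots> \<le> D" using that u unfolding good_def by blast
    finally show "real (\<Sum>v\<in>J' - {u}. w u v) \<le> D" by simp
  qed
  have "\<exists>f. \<forall>J\<subseteq>U. good J \<longrightarrow> P U f J"
  proof (cases "real (card U) \<le> R")
    case True
    then have "P U (\<lambda>_. U) J" if "J \<subseteq> U" for J
      unfolding P_def G_def using that by (intro exI[of _ "{}"]) auto
    then show ?thesis by blast
  next
    case False
    then obtain u where u: "u \<in> U" and deg: "\<delta> * real (card U) \<le> real (\<Sum>v\<in>U - {u}. min (w u v) k)"
      using less.prems(2)[of U] by auto
    have cU: "R < real (card U)" using False by simp
    \<comment> \<open>The vertex \<open>u\<close> and the functions for all smaller vertex sets are
      fixed before \<open>J\<close>, so that the container depends on \<open>T\<close>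
      alone.\<close>
    obtain F where F: "\<And>V J. V \<subset> U \<Longrightarrow> J \<subseteq> V \<Longrightarrow> good J \<Longrightarrow> P V (F V) J"
      using IH by metis
    define N where "N t = {v \<in> U - {u}. t \<le> w u v}" for t
    \<comment> \<open>Replays the run from \<open>T\<close>: \<open>u\<close> was selected iff it
      carries a label in \<open>T\<close>, and the label tells which vertices were removed.\<close>
    define f where "f T = (if \<exists>t. (u, t) \<in> T then
        (let t = (SOME t. (u, t) \<in> T) in F (U - {u} - N t) (T - {(u, t)})) else F (U - {u}) T)" for T
    have "P U f J" if J: "J \<subseteq> U" "good J" for J
    proof (cases "u \<in> J")
      case False
      then have "P (U - {u}) (F (U - {u})) J" using F[of "U - {u}" J] J u by blast
      then obtain T L where TL: "T \<subseteq> (U - {u}) \<times> {1..k}" "L \<subseteq> U - {u}"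
        "real (card T + card L) \<le> G (real (card (U - {u})))"
        "F (U - {u}) T \<subseteq> U - {u}" "real (card (F (U - {u}) T)) \<le> R"
        "J \<subseteq> F (U - {u}) T \<union> fst ` T \<union> L" unfolding P_def by blast
      have fT: "f T = F (U - {u}) T" using TL(1) unfolding f_def by auto
      have "real (card (U - {u})) \<le> real (card U)"
        using less.prems(1) by (simp add: card_mono)
      then have "G (real (card (U - {u}))) \<le> G (real (card U))"
        unfolding G_def using cU R \<delta> D by (auto intro!: mult_left_mono divide_right_mono)
      then show ?thesis unfolding P_def using TL fT
        by (intro exI[of _ T] exI[of _ L]) auto
    next
      case True
      have fin: "finite (U - {u})" "finite J" using less.prems(1) J finite_subset by auto
      have W: "0 < (\<Sum>v\<in>U - {u}. min (w u v) k)"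
      proof -
        have "0 < \<delta> * real (card U)" using \<delta> cU R by (intro mult_pos_pos) linarith+
        then show ?thesis using deg by linarith
      qed
      have "real (\<Sum>v\<in>J - {u}. w u v) \<le> D" using J True unfolding good_def by blast
      then obtain t where t: "t \<in> {1..k}"
        and le: "(1 + real (card {v \<in> J - {u}. t \<le> w u v})) * real (\<Sum>v\<in>U - {u}. min (w u v) k)
          \<le> (real k + D) * real (card (N t))"
        unfolding N_def using ex_threshold[OF fin(1), of "J - {u}" "w u" D k] W J by blast
      define M where "M = {v \<in> J - {u}. t \<le> w u v}"
      \<comment> \<open>The new label counts 1 and the lost elements count |M|; the degree bound
        makes this total at most proportional to the fraction of \<open>U\<close> that is
        removed.\<close>
      have "(1 + real (card M)) * (\<delta> * real (card U)) \<le> (real k + D) * real (card (N t))"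
        using mult_left_mono[OF deg, of "1 + real (card M)"] le unfolding M_def by linarith
      then have cost: "1 + real (card M) \<le> (real k + D) / \<delta> * (real (card (N t)) / real (card U))"
        using \<delta> cU R by (simp add: field_simps)
      define V where "V = U - {u} - N t"
      have V: "V \<subset> U" unfolding V_def using u by blast
      have "J - {u} - M \<subseteq> V" unfolding V_def M_def N_def using J by auto
      moreover have "good (J - {u} - M)" by (rule good_mono[OF J(2) _ fin(2)]) auto
      ultimately have "P V (F V) (J - {u} - M)" by (rule F[OF V])
      then obtain T L where TL: "T \<subseteq> V \<times> {1..k}" "L \<subseteq> V"
        "real (card T + card L) \<le> G (real (card V))"
        "F V T \<subseteq> V" "real (card (F V T)) \<le> R"
        "J - {u} - M \<subseteq> F V T \<union> fst ` T \<union> L" unfolding P_def by blast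
      let ?T = "insert (u, t) T" and ?L = "L \<union> M"
      \<comment> \<open>\<open>T\<close> lives on \<open>V\<close>, which omits \<open>u\<close>;
        hence the label of \<open>u\<close> in \<open>?T\<close> is unique and \<open>f\<close>
        recovers it.\<close>
      have uT: "(u, t') \<notin> T" for t' using TL(1) unfolding V_def by auto
      then have "(SOME t'. (u, t') \<in> ?T) = t" by auto
      then have fT: "f ?T = F V T" unfolding f_def V_def using uT by (auto simp: Let_def)
      have "N t \<subseteq> U - {u}" unfolding N_def by auto
      then have "card V = card (U - {u}) - card (N t)"
        unfolding V_def using less.prems(1) by (intro card_Diff_subset finite_subset[OF _ fin(1)]) auto
      moreover have "card (N t) \<le> card (U - {u})" unfolding N_def using fin by (intro card_mono) auto
      moreover have "card (U - {u}) \<le> card U" using less.prems(1) by (simp add: card_mono)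
      ultimately have cV: "real (card V) \<le> real (card U) - real (card (N t))" by linarith
      have finTL: "finite T" "finite L" "finite M"
        using TL V less.prems(1) fin finite_subset[of T "V \<times> {1..k}"] finite_subset[of V U]
          finite_subset[of L V] unfolding M_def by auto
      have c0: "0 \<le> (real k + D) / \<delta>" using D \<delta> by simp
      have "1 + real (card M) + G (real (card V)) \<le> G (real (card U))"
      proof (cases "real (card V) \<le> R")
        case True
        have "real (card (N t)) / real (card U) \<le> 1"
          using cV cU R by simp
        then have "(real k + D) / \<delta> * (real (card (N t)) / real (card U)) \<le> (real k + D) / \<delta> * 1"
          using c0 by (rule mult_left_mono)
        also have "\<dots> \<le> (real k + D) / \<delta> * (1 + ln (real (card U) / R))"
          using c0 cU R by (intro mult_left_mono) auto
        finally show ?thesis using cost True cU unfolding G_def by simp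
      next
        case False
        have V0: "0 < real (card V)" "0 < real (card U)" using False R cU by linarith+
        have "real (card (N t)) / real (card U) \<le> 1 - real (card V) / real (card U)"
          using cV V0 by (simp add: field_simps)
        \<comment> \<open>The inequality 1 - x \<le> - ln x turns the removed fraction into a drop
          of the potential.\<close>
        also have "\<dots> \<le> - ln (real (card V) / real (card U))"
          using ln_le_minus_one[of "real (card V) / real (card U)"] V0 by simp
        also have "\<dots> = ln (real (card U) / R) - ln (real (card V) / R)"
          using V0 R by (simp add: ln_div)
        finally have "(real k + D) / \<delta> * (real (card (N t)) / real (card U))
            \<le> (real k + D) / \<delta> * (ln (real (card U) / R) - ln (real (card V) / R))"
          using c0 by (rule mult_left_mono)
        then have "1 + real (card M)
            \<le> (real k + D) / \<delta> * (ln (real (card U) / R) - ln (real (card V) / R))"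
          using cost by linarith
        then show ?thesis using False cU unfolding G_def by (simp add: algebra_simps)
      qed
      moreover have "card ?T \<le> 1 + card T" "card ?L \<le> card L + card M"
        using finTL by (simp_all add: card_insert_if card_Un_le)
      ultimately have "real (card ?T + card ?L) \<le> G (real (card U))" using TL(3) by linarith
      moreover have "?T \<subseteq> U \<times> {1..k}" "?L \<subseteq> U" using TL V u t J unfolding M_def by auto
      moreover have "J \<subseteq> f ?T \<union> fst ` ?T \<union> ?L" using TL(6) fT by auto
      moreover have "f ?T \<subseteq> U" "real (card (f ?T)) \<le> R" using fT TL V by auto
      ultimately show ?thesis unfolding P_def by blast
    qed
    then show ?thesis by blast
  qed
  then show ?case unfolding P_def good_def G_def .
qed

section \<open>Edge density and multiplicities in the multigraph of a seed\<close>

text \<open>The edge multiplicity between \<open>u\<close> and \<open>v\<close>, that is, the number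
  of representations of v - u as a difference of two elements of \<open>S\<close>, written with sums
  to avoid subtraction of natural numbers. At u = v it is the diagonal value |S|, which has to be
  discounted later.\<close>

definition same_sum_count :: "nat set \<Rightarrow> nat \<Rightarrow> nat \<Rightarrow> nat" where
  "same_sum_count S u v = card {(a, b) \<in> S \<times> S. u + a = v + b}"

text \<open>The double sum counts pairs of elements of \<open>U \<times> S\<close> with equal sum.
  All sums lie in {1..2n}, and Cauchy-Schwarz over these 2n values gives the bound.\<close>

lemma sum_same_sum_count_ge:
  assumes U: "U \<subseteq> {1..n}" and S: "S \<subseteq> {1..n}"
  shows "(card S * card U)\<^sup>2 \<le> 2 * n * (\<Sum>u\<in>U. \<Sum>v\<in>U. same_sum_count S u v)"
proof -
  have fin: "finite U" "finite S" using U S finite_subset by auto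
  define r where "r k = card {p \<in> U \<times> S. fst p + snd p = k}" for k
  have "(\<Sum>u\<in>U. \<Sum>v\<in>U. same_sum_count S u v)
      = card (SIGMA u:U. SIGMA v:U. {(a, b) \<in> S \<times> S. u + a = v + b})"
  proof -
    have Q: "finite {(a, b) \<in> S \<times> S. u + a = v + b}" for u v
      using fin by (auto intro: finite_subset[of _ "S \<times> S"])
    have "card (SIGMA v:U. {(a, b) \<in> S \<times> S. u + a = v + b}) = (\<Sum>v\<in>U. same_sum_count S u v)" for u
      unfolding same_sum_count_def using fin(1) Q by (intro card_SigmaI) blast+
    moreover have "finite (SIGMA v:U. {(a, b) \<in> S \<times> S. u + a = v + b})" for u
      using fin(1) Q by (intro finite_SigmaI) blast+
    ultimately show ?thesis using fin(1) by (subst card_SigmaI) auto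
  qed
  also have "\<dots> = card (\<Union>k\<in>{1..2*n}. {p \<in> U \<times> S. fst p + snd p = k} \<times> {p \<in> U \<times> S. fst p + snd p = k})"
    (is "card ?A = card ?B")
  proof (rule bij_betw_same_card)
    show "bij_betw (\<lambda>(u, v, a, b). ((u, a), (v, b))) ?A ?B"
    proof (rule bij_betwI[where g = "\<lambda>((u, a), (v, b)). (u, v, a, b)"])
      show "(\<lambda>(u, v, a, b). ((u, a), (v, b))) \<in> ?A \<rightarrow> ?B"
        using U S by (force simp: subset_iff)
    qed auto
  qed
  also have "\<dots> = (\<Sum>k\<in>{1..2*n}. (r k)\<^sup>2)"
    unfolding r_def using fin
    by (subst card_UN_disjoint) (auto simp: card_cartesian_product power2_eq_square)
  finally have eq: "(\<Sum>u\<in>U. \<Sum>v\<in>U. same_sum_count S u v) = (\<Sum>k\<in>{1..2*n}. (r k)\<^sup>2)" .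
  have "card S * card U = card (U \<times> S)" by (simp add: card_cartesian_product)
  also have "U \<times> S = (\<Union>k\<in>{1..2*n}. {p \<in> U \<times> S. fst p + snd p = k})"
    using U S by (force simp: subset_iff)
  also have "card \<dots> = (\<Sum>k\<in>{1..2*n}. r k)"
    unfolding r_def using fin by (subst card_UN_disjoint) auto
  finally have "real ((card S * card U)\<^sup>2) = (\<Sum>k\<in>{1..2*n}. real (r k))\<^sup>2" by simp
  also have "\<dots> \<le> (\<Sum>k\<in>{1..2*n}. (real (r k))\<^sup>2) * real (card {1..2*n})"
    by (rule sum_squared_le_sum_of_squares) 
  also have "\<dots> = real (2 * n * (\<Sum>u\<in>U. \<Sum>v\<in>U. same_sum_count S u v))"
    unfolding eq by simp
  finally show ?thesis using of_nat_le_iff by blast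
qed

lemma finite_sidon_tuples: "finite A \<Longrightarrow> finite (sidon_tuples A)"
  by (rule finite_subset[of _ "A \<times> A \<times> A \<times> A"]) (auto simp: sidon_tuples_def)

text \<open>
  Two distinct representations of the same nonzero difference form a Sidon 4-tuple.
\<close>

lemma sum_same_sum_count_pairs_le:
  assumes "finite S" "finite U"
  shows "(\<Sum>v\<in>U - {u}. same_sum_count S u v * (same_sum_count S u v - 1)) \<le> card (sidon_tuples S)"
proof -
  define Q where "Q v = {(a, b) \<in> S \<times> S. u + a = v + b}" for v
  have finQ: "finite (Q v)" for v
    unfolding Q_def using assms by (auto intro: finite_subset[of _ "S \<times> S"])
  have "same_sum_count S u v = card (Q v)" for v
    unfolding same_sum_count_def Q_def ..
  then have "same_sum_count S u v * (same_sum_count S u v - 1) = card (SIGMA p:Q v. Q v - {p})" for v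
    using finQ by (simp add: card_SigmaI)
  then have "(\<Sum>v\<in>U - {u}. same_sum_count S u v * (same_sum_count S u v - 1))
      = card (SIGMA v:U - {u}. SIGMA p:Q v. Q v - {p})"
    using assms finQ by (subst card_SigmaI) auto
  also have "\<dots> \<le> card (sidon_tuples S)"
  proof (rule card_inj_on_le)
    \<comment> \<open>From u + a = v + b and u + a' = v + b' follows a + b' = a' + b. The two sides
      share no entry because u and v differ and the representations are distinct; \<open>v\<close>
      is recovered from u + a = v + b.\<close>
    show "inj_on (\<lambda>(v, (a, b), (a', b')). (a, b', a', b)) (SIGMA v:U - {u}. SIGMA p:Q v. Q v - {p})"
      by (auto simp: inj_on_def Q_def)
    show "(\<lambda>(v, (a, b), (a', b')). (a, b', a', b)) ` (SIGMA v:U - {u}. SIGMA p:Q v. Q v - {p})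
        \<subseteq> sidon_tuples S"
      by (auto simp: sidon_tuples_def Q_def)
  qed (rule finite_sidon_tuples[OF assms(1)])
  finally show ?thesis .
qed

text \<open>Write s = |S|. By Cauchy-Schwarz the average row sum over \<open>U\<close> is at least
  s^2 |U| / (2 n). The diagonal costs at most s, and truncation at \<open>k\<close> at most s / 2 on
  account of the few Sidon 4-tuples in \<open>S\<close>. As |U| > 4 n / s, the loss 3 s / 2 is below
  3 s^2 |U| / (8 n), which leaves s^2 |U| / (8 n).\<close>

lemma ex_large_truncated_degree:
  fixes k :: nat
  assumes U: "U \<subseteq> {1..n}" and S: "S \<subseteq> {1..n}" "S \<noteq> {}" and n: "0 < n"
    and large: "4 * real n / real (card S) < real (card U)"
    and k: "0 < k" "2 * real (card (sidon_tuples S)) / real (card S) \<le> real k"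
  shows "\<exists>u\<in>U. (real (card S))\<^sup>2 / (8 * real n) * real (card U)
    \<le> real (\<Sum>v\<in>U - {u}. min (same_sum_count S u v) k)"
proof (rule ccontr)
  let ?w = "same_sum_count S"
  define s x N t where "s = real (card S)" and "x = real (card U)" and "N = real n"
    and "t = real (card (sidon_tuples S))"
  have fin: "finite U" "finite S" using U S finite_subset by auto
  have s: "0 < s" unfolding s_def using S(2) fin by (simp add: card_gt_0_iff)
  have N: "0 < N" unfolding N_def using n by simp
  have sx: "4 * N < s * x" using large s unfolding s_def x_def N_def by (simp add: field_simps)
  have "0 < s * x" using sx N by linarith
  then have x: "0 < x" using s by (simp add: zero_less_mult_iff)
  assume "\<not> ?thesis"
  then have small: "real (\<Sum>v\<in>U - {u}. min (?w u v) k) < s\<^sup>2 / (8 * N) * x" if "u \<in> U" for u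
    using that unfolding s_def x_def N_def by (meson not_le)
  have self: "?w u u \<le> card S" for u
  proof -
    have "{(a, b) \<in> S \<times> S. u + a = u + b} = (\<lambda>a. (a, a)) ` S" by auto
    then show ?thesis unfolding same_sum_count_def using fin by (simp add: card_image_le)
  qed
  \<comment> \<open>If w > k then w - 1 \<ge> k, so the excess is charged to the ordered pairs of
    distinct representations, which inject into the Sidon 4-tuples of \<open>S\<close>.\<close>
  have trunc: "real w \<le> real (min w k) + real (w * (w - 1)) / real k" for w :: nat
  proof (cases "w \<le> k")
    case False
    then have "k \<le> w - 1" by linarith
    then have "w * k \<le> w * (w - 1)" by simp
    then have "real w * real k \<le> real (w * (w - 1))" by (metis of_nat_le_iff of_nat_mult)
    then have "real w \<le> real (w * (w - 1)) / real k" using k by (simp add: pos_le_divide_eq)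
    then show ?thesis by linarith
  qed auto
  have row: "real (\<Sum>v\<in>U. ?w u v) < s + s\<^sup>2 / (8 * N) * x + t / real k" if u: "u \<in> U" for u
  proof -
    have "real (\<Sum>v\<in>U. ?w u v) = real (?w u u) + (\<Sum>v\<in>U - {u}. real (?w u v))"
      using u fin by (simp add: sum.remove)
    also have "\<dots> \<le> s + (\<Sum>v\<in>U - {u}. real (min (?w u v) k) + real (?w u v * (?w u v - 1)) / real k)"
      unfolding s_def using self trunc by (intro add_mono sum_mono) auto
    also have "\<dots> = s + real (\<Sum>v\<in>U - {u}. min (?w u v) k)
        + real (\<Sum>v\<in>U - {u}. ?w u v * (?w u v - 1)) / real k"
      by (simp only: sum.distrib of_nat_sum sum_divide_distrib add.assoc)
    also have "\<dots> < s + s\<^sup>2 / (8 * N) * x + t / real k"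
    proof -
      have "real (\<Sum>v\<in>U - {u}. ?w u v * (?w u v - 1)) / real k \<le> t / real k"
        unfolding t_def using sum_same_sum_count_pairs_le[OF fin(2,1), of u]
        by (intro divide_right_mono) (simp_all only: of_nat_le_iff of_nat_0_le_iff)
      then show ?thesis using small[OF u] by linarith
    qed
    finally show ?thesis .
  qed
  have "U \<noteq> {}" using x unfolding x_def by auto
  then have "(\<Sum>u\<in>U. real (\<Sum>v\<in>U. ?w u v)) < (\<Sum>u\<in>U. s + s\<^sup>2 / (8 * N) * x + t / real k)"
    using row fin by (intro sum_strict_mono) auto
  then have up: "real (\<Sum>u\<in>U. \<Sum>v\<in>U. ?w u v) < x * (s + s\<^sup>2 / (8 * N) * x + t / real k)"
    unfolding x_def by simp
  have "real ((card S * card U)\<^sup>2) \<le> real (2 * n * (\<Sum>u\<in>U. \<Sum>v\<in>U. ?w u v))"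
    using sum_same_sum_count_ge[OF U S(1)] of_nat_le_iff by blast
  then have "(s * x)\<^sup>2 \<le> 2 * N * real (\<Sum>u\<in>U. \<Sum>v\<in>U. ?w u v)"
    unfolding s_def x_def N_def by simp
  also have "\<dots> < 2 * N * (x * (s + s\<^sup>2 / (8 * N) * x + t / real k))"
    using up N by simp
  also have "\<dots> = 2 * N * (s * x) + (s * x)\<^sup>2 / 4 + 2 * N * x * (t / real k)"
    using N by (simp add: field_simps power2_eq_square)
  also have "2 * N * x * (t / real k) \<le> 2 * N * x * (s / 2)"
    using k s N x unfolding t_def s_def by (intro mult_left_mono) (simp_all add: field_simps)
  also have "2 * N * x * (s / 2) = N * (s * x)" by simp
  finally have "3 / 4 * (s * x)\<^sup>2 < 3 * N * (s * x)" by simp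
  then have "(s * x) * (s * x) < (4 * N) * (s * x)" by (simp add: power2_eq_square mult_ac)
  then have "s * x < 4 * N" using \<open>0 < s * x\<close> by (simp only: mult_less_cancel_right_pos)
  then show False using sx by simp
qed

subsection \<open>Containers for sets with few Sidon tuples\<close>

text \<open>A single averaging, over the Sidon 4-tuples whose second and fourth entries lie in
  \<open>S\<close>, controls both quantities. These two entries always differ, as the averaging
  requires. An edge between u and v given by (a, b) becomes the tuple (u, a, v, b); that u and v are
  distinct and outside \<open>S\<close> makes its two sides disjoint.\<close>

lemma ex_sparse_seed:
  assumes I: "finite I" and s: "s \<le> card I" and e: "real (card (sidon_tuples I)) * (real s)\<^sup>2 \<le> e * (real (card I))\<^sup>2"
    and I0: "I \<noteq> {}"
  obtains S where "S \<subseteq> I" "card S = s" "real (card (sidon_tuples S)) \<le> e"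
    "real (\<Sum>u\<in>I - S. \<Sum>v\<in>I - S - {u}. same_sum_count S u v) \<le> e"
proof -
  obtain S where S: "S \<subseteq> I" "card S = s"
    and le: "card {q \<in> sidon_tuples I. fst (snd q) \<in> S \<and> snd (snd (snd q)) \<in> S} * (card I)\<^sup>2
      \<le> card (sidon_tuples I) * s\<^sup>2" (is "card ?Q * _ \<le> _")
    using ex_subset_few_pairs[OF I finite_sidon_tuples[OF I], of "\<lambda>q. fst (snd q)" "\<lambda>q. snd (snd (snd q))" s] s
    by (auto simp: sidon_tuples_def)
  have "real (card ?Q) * (real (card I))\<^sup>2 = real (card ?Q * (card I)\<^sup>2)" by simp
  also have "\<dots> \<le> real (card (sidon_tuples I) * s\<^sup>2)" using le by (simp only: of_nat_le_iff)
  also have "\<dots> \<le> e * (real (card I))\<^sup>2" using e by simp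
  finally have Qe: "real (card ?Q) \<le> e" using I I0 by (simp add: card_gt_0_iff)
  have finQ: "finite ?Q" using finite_sidon_tuples[OF I] by simp
  have fin: "finite S" using S I finite_subset by blast
  have "sidon_tuples S \<subseteq> ?Q" using S by (auto simp: sidon_tuples_def)
  then have "card (sidon_tuples S) \<le> card ?Q" using finQ by (rule card_mono[rotated])
  moreover have "(\<Sum>u\<in>I - S. \<Sum>v\<in>I - S - {u}. same_sum_count S u v) \<le> card ?Q"
  proof -
    have P: "finite {(a, b) \<in> S \<times> S. u + a = v + b}" for u v
      using fin by (auto intro: finite_subset[of _ "S \<times> S"])
    have "card (SIGMA v:I - S - {u}. {(a, b) \<in> S \<times> S. u + a = v + b})
        = (\<Sum>v\<in>I - S - {u}. same_sum_count S u v)" for u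
      unfolding same_sum_count_def using I P by (intro card_SigmaI) blast+
    moreover have "finite (SIGMA v:I - S - {u}. {(a, b) \<in> S \<times> S. u + a = v + b})" for u
      using I P by (intro finite_SigmaI) blast+
    ultimately have "(\<Sum>u\<in>I - S. \<Sum>v\<in>I - S - {u}. same_sum_count S u v)
        = card (SIGMA u:I - S. SIGMA v:I - S - {u}. {(a, b) \<in> S \<times> S. u + a = v + b})"
      using I by (subst card_SigmaI) auto
    also have "\<dots> \<le> card ?Q"
    proof (rule card_inj_on_le[OF _ _ finQ])
      show "inj_on (\<lambda>(u, v, a, b). (u, a, v, b))
          (SIGMA u:I - S. SIGMA v:I - S - {u}. {(a, b) \<in> S \<times> S. u + a = v + b})"
        by (auto simp: inj_on_def)
      show "(\<lambda>(u, v, a, b). (u, a, v, b)) `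
          (SIGMA u:I - S. SIGMA v:I - S - {u}. {(a, b) \<in> S \<times> S. u + a = v + b}) \<subseteq> ?Q"
        using S by (auto simp: sidon_tuples_def)
    qed
    finally show ?thesis .
  qed
  ultimately show ?thesis using that[of S] S Qe by linarith
qed

text \<open>A set \<open>I\<close> is encoded by its seed \<open>S\<close>, the labelled vertices
  \<open>T\<close> of the algorithm run on C0 - S, and one further set holding the lost elements
  together with the vertices of degree above \<open>D\<close>, of which there are at most e / D. The
  run stops at size 4 n / s, so \<open>H\<close> bounds its logarithmic factor and
  \<open>\<kappa>\<close> its records.\<close>

lemma sidon_containers:
  fixes e D H :: real and n s k \<kappa> b :: nat
  assumes C0: "C0 \<subseteq> {1..n}" and n: "0 < n" and s: "0 < s" and k: "0 < k" "2 * e / real s \<le> real k"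
    and D: "0 < D" and H: "0 \<le> H" "1 + ln (real (card C0) * real s / (4 * real n)) \<le> H"
    and \<kappa>: "8 * real n / (real s)\<^sup>2 * (real k + D) * H \<le> real \<kappa>" and b: "e / D \<le> real b"
  shows "\<exists>\<C>. finite \<C> \<and> card \<C> \<le> (card C0 choose s) * (n * k + 1) ^ \<kappa> * (n + 1) ^ (\<kappa> + b) \<and>
    (\<forall>C\<in>\<C>. C \<subseteq> C0 \<and> real (card C) \<le> 4 * real n / real s + real s + 2 * real \<kappa> + real b) \<and>
    (\<forall>I\<subseteq>C0. s \<le> card I \<longrightarrow> real (card (sidon_tuples I)) * (real s)\<^sup>2 \<le> e * (real (card I))\<^sup>2 \<longrightarrow>
      (\<exists>C\<in>\<C>. I \<subseteq> C))"
proof -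
  define R where "R = 4 * real n / real s"
  define \<delta> where "\<delta> = (real s)\<^sup>2 / (8 * real n)"
  have R: "0 < R" and \<delta>: "0 < \<delta>" using n s by (auto simp: R_def \<delta>_def)
  have fC0: "finite C0" using C0 finite_subset by blast
  have cC0: "card C0 \<le> n" using card_mono[OF _ C0] by simp
  define As where "As = {S. S \<subseteq> C0 \<and> card S = s}"
  define At where "At = {T. T \<subseteq> C0 \<times> {1..k} \<and> card T \<le> \<kappa>}"
  define Al where "Al = {L. L \<subseteq> C0 \<and> card L \<le> \<kappa> + b}"
  \<comment> \<open>Sparsity of the seed is a premise inside the existential, so that one choice
    function \<open>F\<close> serves all of \<open>As\<close>.\<close>
  have "\<exists>f. real (card (sidon_tuples S)) \<le> e \<longrightarrow> (\<forall>J\<subseteq>C0 - S.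
      (\<forall>u\<in>J. real (\<Sum>v\<in>J - {u}. same_sum_count S u v) \<le> D) \<longrightarrow>
      (\<exists>T L. T \<subseteq> C0 \<times> {1..k} \<and> L \<subseteq> C0 \<and> card T + card L \<le> \<kappa> \<and>
        f T \<subseteq> C0 \<and> real (card (f T)) \<le> R \<and> J \<subseteq> f T \<union> fst ` T \<union> L))" if S: "S \<in> As" for S
  proof (cases "real (card (sidon_tuples S)) \<le> e")
    case True
    have S': "S \<subseteq> {1..n}" "card S = s" "S \<noteq> {}" using S s C0 by (auto simp: As_def)
    have fU: "finite (C0 - S)" using fC0 by simp
    have k': "2 * real (card (sidon_tuples S)) / real (card S) \<le> real k"
    proof -
      have "2 * real (card (sidon_tuples S)) / real s \<le> 2 * e / real s"
        using True by (intro divide_right_mono mult_left_mono) auto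
      then show ?thesis using k(2) unfolding S'(2) by linarith
    qed
    have dense: "\<exists>u\<in>V. \<delta> * real (card V) \<le> real (\<Sum>v\<in>V - {u}. min (same_sum_count S u v) k)"
      if "V \<subseteq> C0 - S" "R < real (card V)" for V
      using ex_large_truncated_degree[of V n S k] that S' n k(1) k' C0 unfolding R_def \<delta>_def by auto
    have G: "(if real (card (C0 - S)) \<le> R then 0
        else (real k + D) / \<delta> * (1 + ln (real (card (C0 - S)) / R))) \<le> real \<kappa>"
    proof (cases "real (card (C0 - S)) \<le> R")
      case False
      have "real (card (C0 - S)) \<le> real (card C0)" using fC0 by (simp add: card_mono)
      then have "ln (real (card (C0 - S)) / R) \<le> ln (real (card C0) / R)"
        using False R by (intro ln_mono divide_right_mono divide_pos_pos) linarith+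
      also have "real (card C0) / R = real (card C0) * real s / (4 * real n)"
        unfolding R_def by simp
      finally have "1 + ln (real (card (C0 - S)) / R) \<le> H" using H by linarith
      then have "(real k + D) / \<delta> * (1 + ln (real (card (C0 - S)) / R)) \<le> (real k + D) / \<delta> * H"
        using D \<delta> by (intro mult_left_mono) auto
      also have "\<dots> = 8 * real n / (real s)\<^sup>2 * (real k + D) * H"
        unfolding \<delta>_def using s n by (simp add: field_simps)
      finally show ?thesis using \<kappa> False by simp
    qed simp
    obtain f where f: "\<And>J. J \<subseteq> C0 - S \<Longrightarrow> (\<forall>u\<in>J. real (\<Sum>v\<in>J - {u}. same_sum_count S u v) \<le> D) \<Longrightarrow>
      (\<exists>T L. T \<subseteq> (C0 - S) \<times> {1..k} \<and> L \<subseteq> C0 - S \<and>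
        real (card T + card L) \<le> (if real (card (C0 - S)) \<le> R then 0
          else (real k + D) / \<delta> * (1 + ln (real (card (C0 - S)) / R))) \<and>
        f T \<subseteq> C0 - S \<and> real (card (f T)) \<le> R \<and> J \<subseteq> f T \<union> fst ` T \<union> L)"
      using weighted_containers[OF fU \<delta> R less_imp_le[OF D] dense] by metis
    show ?thesis
    proof (intro exI[of _ f] impI allI)
      fix J assume "J \<subseteq> C0 - S" "\<forall>u\<in>J. real (\<Sum>v\<in>J - {u}. same_sum_count S u v) \<le> D"
      from f[OF this] obtain T L where TL: "T \<subseteq> (C0 - S) \<times> {1..k}" "L \<subseteq> C0 - S"
        "real (card T + card L) \<le> (if real (card (C0 - S)) \<le> R then 0
          else (real k + D) / \<delta> * (1 + ln (real (card (C0 - S)) / R)))"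
        "f T \<subseteq> C0 - S" "real (card (f T)) \<le> R" "J \<subseteq> f T \<union> fst ` T \<union> L" by blast
      have "real (card T + card L) \<le> real \<kappa>" using TL(3) G by linarith
      then have "card T + card L \<le> \<kappa>" by (simp only: of_nat_le_iff)
      then show "\<exists>T L. T \<subseteq> C0 \<times> {1..k} \<and> L \<subseteq> C0 \<and> card T + card L \<le> \<kappa> \<and>
        f T \<subseteq> C0 \<and> real (card (f T)) \<le> R \<and> J \<subseteq> f T \<union> fst ` T \<union> L"
        using TL by (intro exI[of _ T] exI[of _ L]) auto
    qed
  qed auto
  then obtain F where F: "\<And>S J. S \<in> As \<Longrightarrow> real (card (sidon_tuples S)) \<le> e \<Longrightarrow> J \<subseteq> C0 - S \<Longrightarrow>
      (\<forall>u\<in>J. real (\<Sum>v\<in>J - {u}. same_sum_count S u v) \<le> D) \<Longrightarrow>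
      (\<exists>T L. T \<subseteq> C0 \<times> {1..k} \<and> L \<subseteq> C0 \<and> card T + card L \<le> \<kappa> \<and>
        F S T \<subseteq> C0 \<and> real (card (F S T)) \<le> R \<and> J \<subseteq> F S T \<union> fst ` T \<union> L)"
    by metis
  define g where "g = (\<lambda>(S, T, L). F S T \<union> fst ` T \<union> L \<union> S)"
  \<comment> \<open>An arbitrary triple may give a set that is too large or leaves
    \<open>C0\<close>. Such sets are discarded; the triples encoding actual sets \<open>I\<close>
    survive.\<close>
  define \<C> where "\<C> = {C \<in> g ` (As \<times> At \<times> Al).
    C \<subseteq> C0 \<and> real (card C) \<le> R + real s + 2 * real \<kappa> + real b}"
  have fins: "finite As" "finite At" "finite Al"
    unfolding As_def At_def Al_def using fC0 by auto
  have cAt: "card At \<le> (n * k + 1) ^ \<kappa>"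
  proof -
    have "card At \<le> (card (C0 \<times> {1..k}) + 1) ^ \<kappa>"
      unfolding At_def using fC0 by (intro card_subsets_card_le) auto
    also have "\<dots> \<le> (n * k + 1) ^ \<kappa>"
      using cC0 by (intro power_mono) (auto simp: card_cartesian_product)
    finally show ?thesis .
  qed
  have cAl: "card Al \<le> (n + 1) ^ (\<kappa> + b)"
  proof -
    have "card Al \<le> (card C0 + 1) ^ (\<kappa> + b)"
      unfolding Al_def using fC0 by (rule card_subsets_card_le)
    also have "\<dots> \<le> (n + 1) ^ (\<kappa> + b)" using cC0 by (intro power_mono) auto
    finally show ?thesis .
  qed
  have "card \<C> \<le> card (g ` (As \<times> At \<times> Al))"
    unfolding \<C>_def using fins by (intro card_mono) auto
  also have "\<dots> \<le> card (As \<times> At \<times> Al)" using fins by (intro card_image_le) auto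
  also have "\<dots> = (card C0 choose s) * (card At * card Al)"
    using n_subsets[OF fC0] by (simp add: card_cartesian_product As_def)
  also have "\<dots> \<le> (card C0 choose s) * ((n * k + 1) ^ \<kappa> * (n + 1) ^ (\<kappa> + b))"
    by (intro mult_le_mono order_refl cAt cAl)
  finally have card: "card \<C> \<le> (card C0 choose s) * (n * k + 1) ^ \<kappa> * (n + 1) ^ (\<kappa> + b)"
    by (simp add: mult.assoc)
  have cover: "\<exists>C\<in>\<C>. I \<subseteq> C" if I: "I \<subseteq> C0" "s \<le> card I"
      "real (card (sidon_tuples I)) * (real s)\<^sup>2 \<le> e * (real (card I))\<^sup>2" for I
  proof -
    have fI: "finite I" using I fC0 finite_subset by blast
    have "I \<noteq> {}" using I s by auto
    then obtain S where S: "S \<subseteq> I" "card S = s" and tS: "real (card (sidon_tuples S)) \<le> e"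
      and eS: "real (\<Sum>u\<in>I - S. \<Sum>v\<in>I - S - {u}. same_sum_count S u v) \<le> e"
      using ex_sparse_seed[OF fI I(2,3)] by blast
    define W where "W u = (\<Sum>v\<in>I - S - {u}. same_sum_count S u v)" for u
    define B where "B = {u \<in> I - S. D < real (W u)}"
    have SA: "S \<in> As" using S I by (auto simp: As_def)
    have cB: "card B \<le> b"
    proof -
      have "real (card B) * D = (\<Sum>u\<in>B. D)" by simp
      also have "\<dots> \<le> (\<Sum>u\<in>B. real (W u))" by (intro sum_mono) (auto simp: B_def)
      also have "\<dots> \<le> (\<Sum>u\<in>I - S. real (W u))"
        using fI by (intro sum_mono2) (auto simp: B_def)
      also have "\<dots> \<le> e" using eS by (simp add: W_def)
      finally have "real (card B) \<le> e / D" using D by (simp add: field_simps)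
      then show ?thesis using b by linarith
    qed
    define J where "J = I - S - B"
    have "J \<subseteq> C0 - S" using I unfolding J_def by auto
    moreover have "\<forall>u\<in>J. real (\<Sum>v\<in>J - {u}. same_sum_count S u v) \<le> D"
    proof
      fix u assume u: "u \<in> J"
      have "(\<Sum>v\<in>J - {u}. same_sum_count S u v) \<le> W u"
        unfolding W_def using fI by (intro sum_mono2) (auto simp: J_def)
      moreover have "real (W u) \<le> D" using u unfolding J_def B_def by auto
      ultimately show "real (\<Sum>v\<in>J - {u}. same_sum_count S u v) \<le> D" by linarith
    qed
    ultimately obtain T L where TL: "T \<subseteq> C0 \<times> {1..k}" "L \<subseteq> C0" "card T + card L \<le> \<kappa>"
        "F S T \<subseteq> C0" "real (card (F S T)) \<le> R" "J \<subseteq> F S T \<union> fst ` T \<union> L"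
      using F[OF SA tS] by metis
    have cLB: "card (L \<union> B) \<le> \<kappa> + b" using card_Un_le[of L B] cB TL(3) by linarith
    have BC: "B \<subseteq> C0" using I unfolding B_def by auto
    define C where "C = g (S, T, L \<union> B)"
    have C: "C = F S T \<union> fst ` T \<union> (L \<union> B) \<union> S" unfolding C_def g_def by simp
    have "(S, T, L \<union> B) \<in> As \<times> At \<times> Al"
      using SA TL cLB BC by (auto simp: At_def Al_def)
    then have "C \<in> g ` (As \<times> At \<times> Al)" unfolding C_def by (rule imageI)
    moreover have "C \<subseteq> C0" unfolding C using TL BC S I by auto
    moreover have "real (card C) \<le> R + real s + 2 * real \<kappa> + real b"
    proof -
      have "finite T" using TL(1) fC0 finite_subset[of T "C0 \<times> {1..k}"] by blast
      then have "card (fst ` T) \<le> card T" by (rule card_image_le)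
      moreover have "card C \<le> card (F S T) + card (fst ` T) + card (L \<union> B) + card S"
        unfolding C by (meson add_le_mono1 card_Un_le order_trans)
      ultimately show ?thesis using TL(3,5) cLB S by linarith
    qed
    ultimately have "C \<in> \<C>" unfolding \<C>_def by simp
    moreover have "I \<subseteq> C" using TL(6) unfolding C J_def by blast
    ultimately show ?thesis by blast
  qed
  show ?thesis
    using card cover fins unfolding R_def[symmetric]
    by (intro exI[of _ \<C>]) (auto simp: \<C>_def)
qed

subsection \<open>Iterating with doubled seeds\<close>

text \<open>The size is fixed so that the same seed sizes suit all members and the recursion can end
  with a single binomial coefficient.\<close>

definition sized_family :: "real \<Rightarrow> nat \<Rightarrow> nat set \<Rightarrow> nat set set" where
  "sized_family \<alpha> m C = {I. I \<subseteq> C \<and> card I = m \<and> real (card (sidon_tuples I)) \<le> \<alpha>}"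

lemma card_sized_family_le_binomial:
  assumes "finite C"
  shows "card (sized_family \<alpha> m C) \<le> card C choose m"
proof -
  have "card (sized_family \<alpha> m C) \<le> card {I. I \<subseteq> C \<and> card I = m}"
    unfolding sized_family_def using assms by (intro card_mono) auto
  then show ?thesis using n_subsets[OF assms] by simp
qed

lemma card_sized_family_le_containers:
  assumes "finite \<C>" and fin: "\<And>C. C \<in> \<C> \<Longrightarrow> finite C"
    and X: "\<And>C. C \<in> \<C> \<Longrightarrow> real (card (sized_family \<alpha> m C)) \<le> X"
    and cover: "\<And>I. I \<in> sized_family \<alpha> m C0 \<Longrightarrow> \<exists>C\<in>\<C>. I \<subseteq> C"
  shows "real (card (sized_family \<alpha> m C0)) \<le> real (card \<C>) * X"
proof -
  have "sized_family \<alpha> m C0 \<subseteq> (\<Union>C\<in>\<C>. sized_family \<alpha> m C)"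
    using cover by (fastforce simp: sized_family_def)
  moreover have "finite (sized_family \<alpha> m C)" if "C \<in> \<C>" for C
    unfolding sized_family_def using fin[OF that] by simp
  ultimately have "card (sized_family \<alpha> m C0) \<le> card (\<Union>C\<in>\<C>. sized_family \<alpha> m C)"
    using assms(1) by (intro card_mono) auto
  also have "\<dots> \<le> (\<Sum>C\<in>\<C>. card (sized_family \<alpha> m C))"
    using assms(1) by (rule card_UN_le)
  finally have "real (card (sized_family \<alpha> m C0)) \<le> (\<Sum>C\<in>\<C>. real (card (sized_family \<alpha> m C)))"
    by (metis of_nat_le_iff of_nat_sum)
  also have "\<dots> \<le> real (card \<C>) * X" using X by (rule sum_bounded_above)
  finally show ?thesis .
qed

lemma exp_le_two_powr:
  fixes y :: real
  assumes "0 \<le> y"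
  shows "exp (4 * y) \<le> 2 powr (6 * y)"
proof -
  have "4 * y \<le> 6 * y * ln 2"
    using mult_left_mono[OF ln2_ge_two_thirds, of "6 * y"] assms by simp
  then show ?thesis by (simp add: powr_def)
qed

text \<open>With e = s^2 / L^3, the bounds m^2 \<ge> n / L and n / L^4 on the number of Sidon
  4-tuples give exactly the sparsity that the choice of a seed demands. The parameter
  \<open>\<mu>\<close> sets the degree cutoff D = \<mu> s^2 and trades the share 8 n \<mu> H of the
  run against the at most 1 / (L^3 \<mu>) vertices above the cutoff.\<close>

lemma card_sized_family_stage:
  fixes \<mu> H X L :: real and n m s \<kappa> b :: nat
  assumes C0: "C0 \<subseteq> {1..n}" and L: "L = log 2 (real n)" "1 \<le> L"
    and n: "2 * sqrt (real n) + 3 \<le> real n"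
    and s: "s \<le> m" "real s \<le> sqrt (real n)" "sqrt (real n) / L \<le> real s"
    and m: "sqrt (real n) / sqrt L \<le> real m"
    and \<mu>: "0 < \<mu>" and H: "0 \<le> H" "1 + ln (real (card C0) * real s / (4 * real n)) \<le> H"
    and \<kappa>: "(16 * sqrt (real n) / L\<^sup>2 + 16 * L\<^sup>2 + 8 * real n * \<mu>) * H \<le> real \<kappa>"
    and b: "1 / (L ^ 3 * \<mu>) \<le> real b" and \<kappa>b: "2 * real \<kappa> + real b \<le> sqrt (real n)"
    and X: "\<And>C. C \<subseteq> {1..n} \<Longrightarrow> real (card C) \<le> 6 * real n / real s \<Longrightarrow>
      real (card (sized_family (real n / L ^ 4) m C)) \<le> X" and X0: "0 \<le> X"
  shows "real (card (sized_family (real n / L ^ 4) m C0))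
    \<le> real (card C0 choose s) * 2 powr (2 * L * (2 * real \<kappa> + real b)) * X"
proof -
  define r where "r = sqrt (real n)"
  have n0: "3 \<le> real n" using n by (smt (verit) real_sqrt_ge_zero of_nat_0_le_iff)
  have r: "0 < r" "real n = r\<^sup>2" using n0 unfolding r_def by auto
  have s0: "0 < real s" using s(3) r L unfolding r_def by (smt (verit) divide_pos_pos)
  have rs: "r / real s \<le> L" using s(3) s0 L(2) unfolding r_def[symmetric] by (simp add: field_simps)
  define e where "e = (real s)\<^sup>2 / L ^ 3"
  define k where "k = nat \<lceil>2 * e / real s\<rceil> + 1"
  have e_s: "2 * e / real s = 2 * real s / L ^ 3"
    unfolding e_def using s0 by (simp add: power2_eq_square field_simps)
  have e_s0: "0 \<le> 2 * e / real s" unfolding e_s using s0 L by simp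
  have k: "0 < k" "2 * e / real s \<le> real k" "real k \<le> 2 * real s / L ^ 3 + 2"
    unfolding k_def using e_s0 e_s by linarith+
  define D where "D = \<mu> * (real s)\<^sup>2"
  have D: "0 < D" unfolding D_def using \<mu> s0 by simp
  have eD: "e / D \<le> real b" unfolding e_def D_def using b s0 by simp
  have cost: "8 * real n / (real s)\<^sup>2 * (real k + D) * H \<le> real \<kappa>"
  proof -
    \<comment> \<open>The three resulting summands stem from the two parts of the bound on
      \<open>k\<close> and from \<open>D\<close>; r / s \<le> L then removes \<open>s\<close> from
      them.\<close>
    have "8 * real n / (real s)\<^sup>2 * (real k + D) \<le> 8 * real n / (real s)\<^sup>2 * (2 * real s / L ^ 3 + 2 + D)"
      using k(3) by (intro mult_left_mono) auto
    also have "\<dots> = 16 * r * (r / real s) / L ^ 3 + 16 * (r / real s)\<^sup>2 + 8 * real n * \<mu>"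
      unfolding D_def r(2) using s0 L(2) by (simp add: field_simps power2_eq_square)
    also have "\<dots> \<le> 16 * r * L / L ^ 3 + 16 * L\<^sup>2 + 8 * real n * \<mu>"
      using rs r(1) s0 L(2) by (intro add_mono mult_left_mono divide_right_mono power_mono order_refl) auto
    also have "16 * r * L / L ^ 3 = 16 * r / L\<^sup>2"
      using L(2) by (simp add: power2_eq_square power3_eq_cube)
    finally have "8 * real n / (real s)\<^sup>2 * (real k + D) * H
        \<le> (16 * r / L\<^sup>2 + 16 * L\<^sup>2 + 8 * real n * \<mu>) * H"
      using H(1) by (rule mult_right_mono)
    then show ?thesis using \<kappa> unfolding r_def by linarith
  qed
  have npos: "0 < n" "0 < s" using n0 s0 by auto
  obtain \<C> where \<C>: "finite \<C>"
    and card: "card \<C> \<le> (card C0 choose s) * (n * k + 1) ^ \<kappa> * (n + 1) ^ (\<kappa> + b)"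
    and size: "\<And>C. C \<in> \<C> \<Longrightarrow> C \<subseteq> C0 \<and> real (card C) \<le> 4 * real n / real s + real s + 2 * real \<kappa> + real b"
    and cover: "\<And>I. I \<subseteq> C0 \<Longrightarrow> s \<le> card I \<Longrightarrow>
      real (card (sidon_tuples I)) * (real s)\<^sup>2 \<le> e * (real (card I))\<^sup>2 \<Longrightarrow> \<exists>C\<in>\<C>. I \<subseteq> C"
    using sidon_containers[OF C0 npos(1) npos(2) k(1) k(2) D H cost eD] by metis
  have small: "real (card C) \<le> 6 * real n / real s" if "C \<in> \<C>" for C
  proof -
    \<comment> \<open>The seed and the recorded elements contribute at most r \<le> n / s each,
      which turns 4 n / s into 6 n / s.\<close>
    have "r \<le> real n / real s" unfolding r(2) using s(2) s0 r(1) unfolding r_def[symmetric]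
      by (simp add: field_simps power2_eq_square)
    then show ?thesis using size[OF that] \<kappa>b s(2) unfolding r_def[symmetric] by linarith
  qed
  have "real (card (sized_family (real n / L ^ 4) m C0)) \<le> real (card \<C>) * X"
  proof (rule card_sized_family_le_containers[OF \<C>])
    show "finite C" if "C \<in> \<C>" for C
      by (rule finite_subset[OF subset_trans[OF conjunct1[OF size[OF that]] C0]]) simp
    show "real (card (sized_family (real n / L ^ 4) m C)) \<le> X" if "C \<in> \<C>" for C
      by (rule X[OF subset_trans[OF conjunct1[OF size[OF that]] C0] small[OF that]])
    fix I assume I: "I \<in> sized_family (real n / L ^ 4) m C0"
    show "\<exists>C\<in>\<C>. I \<subseteq> C"
    proof (rule cover)
      have "r / sqrt L \<le> real m" using m unfolding r_def .
      then have "(r / sqrt L)\<^sup>2 \<le> (real m)\<^sup>2" using r(1) L(2) by (intro power_mono) auto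
      then have "real n / L \<le> (real m)\<^sup>2" using L(2) r(2) by (simp add: power_divide)
      then have "real n / L / L ^ 3 \<le> (real m)\<^sup>2 / L ^ 3" using L(2) by (intro divide_right_mono) auto
      moreover have "real n / L / L ^ 3 = real n / L ^ 4" by (simp add: eval_nat_numeral)
      ultimately have "real (card (sidon_tuples I)) \<le> (real m)\<^sup>2 / L ^ 3"
        using I unfolding sized_family_def by auto
      then have "real (card (sidon_tuples I)) * (real s)\<^sup>2 \<le> (real m)\<^sup>2 / L ^ 3 * (real s)\<^sup>2"
        by (rule mult_right_mono) simp
      then show "real (card (sidon_tuples I)) * (real s)\<^sup>2 \<le> e * (real (card I))\<^sup>2"
        using I unfolding e_def sized_family_def by (simp add: mult.commute)
    qed (use I s(1) in \<open>auto simp: sized_family_def\<close>)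
  qed
  also have "\<dots> \<le> real (card C0 choose s) * 2 powr (2 * L * (2 * real \<kappa> + real b)) * X"
  proof (rule mult_right_mono[OF _ X0])
    \<comment> \<open>Each recorded item costs a factor of at most n^2 = 2^(2 L), and there are at
      most 2 \<kappa> + b of them.\<close>
    have nL: "2 powr (2 * L) = (real n)\<^sup>2"
      unfolding L(1) using n0 by (simp add: powr_powr[symmetric] mult.commute[of 2] powr_numeral)
    have "real s / L ^ 3 \<le> r" using s(2) s0 L(2) unfolding r_def[symmetric]
      by (smt (verit) divide_le_eq_1 frac_le one_le_power div_by_1)
    then have "real k \<le> real n - 1" using k(3) n unfolding r_def[symmetric] by linarith
    then have "real n * real k + 1 \<le> real n * (real n - 1) + real n"
      using n0 by (intro add_mono mult_left_mono) auto
    then have a1: "real (n * k + 1) \<le> 2 powr (2 * L)"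
      unfolding nL by (simp add: power2_eq_square algebra_simps)
    have "real n + 1 \<le> real n * real n" using n0 mult_mono[of 3 "real n" "real n" "real n"] by linarith
    then have a2: "real (n + 1) \<le> 2 powr (2 * L)" unfolding nL by (simp add: power2_eq_square)
    have "real ((n * k + 1) ^ \<kappa> * (n + 1) ^ (\<kappa> + b)) = real (n * k + 1) ^ \<kappa> * real (n + 1) ^ (\<kappa> + b)"
      by (simp only: of_nat_mult of_nat_power)
    also have "\<dots> \<le> (2 powr (2 * L)) ^ \<kappa> * (2 powr (2 * L)) ^ (\<kappa> + b)"
      using a1 a2 by (intro mult_mono power_mono) auto
    also have "\<dots> = (2 powr (2 * L)) ^ (2 * \<kappa> + b)"
      by (simp only: power_add[symmetric] mult_2 add.assoc)
    also have "\<dots> = 2 powr (2 * L * (2 * real \<kappa> + real b))"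
      by (subst powr_realpow[symmetric]) (simp_all add: powr_powr)
    finally have "real (card C0 choose s) * real ((n * k + 1) ^ \<kappa> * (n + 1) ^ (\<kappa> + b))
        \<le> real (card C0 choose s) * 2 powr (2 * L * (2 * real \<kappa> + real b))"
      by (rule mult_left_mono) simp
    moreover have "real (card \<C>) \<le> real ((card C0 choose s) * ((n * k + 1) ^ \<kappa> * (n + 1) ^ (\<kappa> + b)))"
      using card by (simp only: of_nat_le_iff mult.assoc)
    ultimately show "real (card \<C>) \<le> real (card C0 choose s) * 2 powr (2 * L * (2 * real \<kappa> + real b))"
      by (simp only: of_nat_mult)
  qed
  finally show ?thesis .
qed

text \<open>\<open>C\<close> plays the role of a container from a seed of size \<open>s\<close>; the
  next seed has size 2 s. Choosing it costs 2^(16 z) with z = sqrt (s sqrt n). Doubling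
  \<open>s\<close> multiplies z by sqrt 2 \<ge> 7/5, so the term - 40 z drops by at least 16 z and
  pays for the choice. The constant 56 = 40 + 16 covers the end of the recursion, where z \<le> sqrt
  n, and every doubling spends one \<open>\<epsilon>\<close> of the logarithmic term.\<close>

lemma card_sized_family_iterate:
  fixes \<mu> L \<epsilon> :: real and n m s \<kappa> b :: nat
  assumes L: "L = log 2 (real n)" "1 \<le> L"
    and n: "2 * sqrt (real n) + 3 \<le> real n"
    and m: "sqrt (real n) / sqrt L \<le> real m" and \<mu>: "0 < \<mu>"
    and \<kappa>: "(16 * sqrt (real n) / L\<^sup>2 + 16 * L\<^sup>2 + 8 * real n * \<mu>) * 3 \<le> real \<kappa>"
    and b: "1 / (L ^ 3 * \<mu>) \<le> real b" and \<kappa>b: "2 * real \<kappa> + real b \<le> sqrt (real n)"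
    and \<epsilon>: "2 * L * (2 * real \<kappa> + real b) \<le> \<epsilon>"
    and s: "s \<le> m" "real s \<le> sqrt (real n)" "sqrt (real n) / L \<le> real s"
    and C: "C \<subseteq> {1..n}" "real (card C) \<le> 6 * real n / real s"
  shows "real (card (sized_family (real n / L ^ 4) m C))
    \<le> 2 powr (56 * sqrt (real n) - 40 * sqrt (real s * sqrt (real n)) + \<epsilon> * log 2 (sqrt (real n) / real s))"
  using s C
proof (induction "n - s" arbitrary: s C rule: less_induct)
  case less
  define r where "r = sqrt (real n)"
  define z where "z = sqrt (real s * r)"
  have n0: "3 \<le> real n" using n by (smt (verit) real_sqrt_ge_zero of_nat_0_le_iff)
  have r: "0 < r" "real n = r\<^sup>2" using n0 unfolding r_def by auto
  have sr: "real s \<le> r" "r / L \<le> real s" using less.prems unfolding r_def by auto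
  have s0: "0 < real s" using sr(2) r L by (smt (verit) divide_pos_pos)
  have z: "0 < z" "z\<^sup>2 = real s * r" unfolding z_def using s0 r by auto
  have zr: "z \<le> r"
  proof (rule power2_le_imp_le)
    show "z\<^sup>2 \<le> r\<^sup>2" unfolding z(2) using sr(1) r(1) by (simp add: power2_eq_square)
  qed (use r in simp)
  have \<epsilon>0: "0 \<le> \<epsilon>" using \<epsilon> L(2) by (smt (verit) mult_nonneg_nonneg of_nat_0_le_iff)
  have log0: "0 \<le> \<epsilon> * log 2 (r / real s)" using \<epsilon>0 sr(1) s0 by simp
  have fC: "finite C" using less.prems finite_subset by blast
  \<comment> \<open>With |C| \<le> 6 n / s and j \<le> 2 s the fourth-power condition follows from
    48 z^4 \<le> (8 z / 3)^4; the exponent is then 6 times 8 / 3, which is 16.\<close>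
  have binom: "real (card C choose j) \<le> 2 powr (16 * z)" if j: "j \<le> 2 * s" for j
  proof -
    have "real j ^ 3 * real (card C) \<le> (2 * real s) ^ 3 * (6 * real n / real s)"
      using j less.prems(5) by (intro mult_mono power_mono) auto
    also have "\<dots> = 48 * (z\<^sup>2)\<^sup>2"
      unfolding z(2) r(2) using s0 by (simp add: eval_nat_numeral field_simps)
    also have "\<dots> = 48 * z ^ 4" by simp
    also have "\<dots> \<le> (8 / 3 * z) ^ 4" by (simp add: power_mult_distrib power_divide)
    finally have "real (card C choose j) \<le> exp (4 * (8 / 3 * z))"
      using z(1) by (intro binomial_le_exp) auto
    also have "\<dots> \<le> 2 powr (6 * (8 / 3 * z))" using z(1) by (intro exp_le_two_powr) auto
    finally show ?thesis by simp
  qed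
  \<comment> \<open>Either a doubled seed still fits, or \<open>m\<close> is so small that the
    binomial coefficient is affordable, or \<open>C\<close> has at most 12 r elements and all its
    subsets can be counted.\<close>
  consider "2 * s \<le> m" "2 * real s \<le> r" | "m < 2 * s" | "r < 2 * real s" by linarith
  then have "real (card (sized_family (real n / L ^ 4) m C)) \<le> 2 powr (56 * r - 40 * z + \<epsilon> * log 2 (r / real s))"
  proof cases
    case 1
    define z' where "z' = sqrt (real (2 * s) * r)"
    have z': "7 / 5 * z \<le> z'"
    proof -
      have "z' = sqrt 2 * z" unfolding z'_def z_def by (simp add: real_sqrt_mult)
      moreover have "7 / 5 \<le> sqrt (2::real)" by (rule real_le_rsqrt) (simp add: power2_eq_square)
      ultimately show ?thesis using z(1) by simp
    qed
    define X where "X = 2 powr (56 * r - 40 * z' + \<epsilon> * log 2 (r / real (2 * s)))"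
    have "real (card (sized_family (real n / L ^ 4) m C))
        \<le> real (card C choose (2 * s)) * 2 powr (2 * L * (2 * real \<kappa> + real b)) * X"
    proof (rule card_sized_family_stage[OF less.prems(4) L n 1(1) _ _ m \<mu> _ _ \<kappa> b \<kappa>b])
      show "real (2 * s) \<le> sqrt (real n)" using 1 unfolding r_def by simp
      show "sqrt (real n) / L \<le> real (2 * s)" using sr unfolding r_def by simp
      \<comment> \<open>By |C| \<le> 6 n / s the argument of the logarithm is at most 3, and ln y
        \<le> y - 1 \<le> 2.\<close>
      show "1 + ln (real (card C) * real (2 * s) / (4 * real n)) \<le> 3"
      proof (cases "card C = 0")
        case False
        define y where "y = real (card C) * real (2 * s) / (4 * real n)"
        have "real (card C) * real s \<le> 6 * real n" using less.prems(5) s0 by (simp add: field_simps)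
        then have "y \<le> 3" unfolding y_def using n0 by (simp add: field_simps)
        moreover have "0 < y" unfolding y_def using False s0 n0 by simp
        ultimately show ?thesis using ln_le_minus_one[of y] unfolding y_def[symmetric] by linarith
      qed simp
      show "real (card (sized_family (real n / L ^ 4) m C')) \<le> X"
        if "C' \<subseteq> {1..n}" "real (card C') \<le> 6 * real n / real (2 * s)" for C'
        unfolding X_def z'_def r_def
      proof (rule less.hyps)
        have "r \<le> real n" unfolding r(2) using r(1) n0 unfolding r(2)
          by (smt (verit) power2_eq_square mult_le_cancel_right1 power2_le_imp_le one_power2 mult_less_cancel_right2)
        then have "2 * s \<le> n" using 1(2) by linarith
        then show "n - 2 * s < n - s" using s0 by simp
        show "2 * s \<le> m" by fact
        show "real (2 * s) \<le> sqrt (real n)" using 1 unfolding r_def by simp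
        show "sqrt (real n) / L \<le> real (2 * s)" using sr unfolding r_def by simp
      qed fact+
    qed (simp_all add: X_def)
    also have "\<dots> \<le> 2 powr (16 * z) * 2 powr \<epsilon> * X"
      using binom[of "2 * s"] \<epsilon> by (intro mult_mono) (auto simp: X_def)
    also have "\<dots> = 2 powr (16 * z + \<epsilon> + (56 * r - 40 * z' + \<epsilon> * log 2 (r / real (2 * s))))"
      unfolding X_def by (simp only: powr_add)
    also have "\<dots> \<le> 2 powr (56 * r - 40 * z + \<epsilon> * log 2 (r / real s))"
    proof (rule powr_mono)
      have "log 2 (r / real (2 * s)) = log 2 (r / real s) - 1"
        using r s0 by (simp add: log_divide log_mult)
      then have "\<epsilon> * log 2 (r / real (2 * s)) = \<epsilon> * log 2 (r / real s) - \<epsilon>"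
        by (simp add: right_diff_distrib)
      then show "16 * z + \<epsilon> + (56 * r - 40 * z' + \<epsilon> * log 2 (r / real (2 * s)))
          \<le> 56 * r - 40 * z + \<epsilon> * log 2 (r / real s)" using z' by linarith
    qed simp
    finally show ?thesis .
  next
    case 2
    have "real (card (sized_family (real n / L ^ 4) m C)) \<le> real (card C choose m)"
      using card_sized_family_le_binomial[OF fC] by simp
    also have "\<dots> \<le> 2 powr (16 * z)" using binom[of m] 2 by simp
    also have "\<dots> \<le> 2 powr (56 * r - 40 * z + \<epsilon> * log 2 (r / real s))"
      using zr log0 by (intro powr_mono) auto
    finally show ?thesis .
  next
    case 3
    have "6 * real n / real s \<le> 12 * r"
      unfolding r(2) using 3 r(1) s0 by (simp add: field_simps power2_eq_square)
    then have cC: "real (card C) \<le> 12 * r" using less.prems(5) by linarith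
    have "real (card (sized_family (real n / L ^ 4) m C)) \<le> real (card C choose m)"
      using card_sized_family_le_binomial[OF fC] by simp
    also have "\<dots> \<le> real (2 ^ card C)" using binomial_le_pow2 of_nat_le_iff by blast
    also have "\<dots> = 2 powr real (card C)" by (simp add: powr_realpow)
    also have "\<dots> \<le> 2 powr (56 * r - 40 * z + \<epsilon> * log 2 (r / real s))"
      using zr log0 cC r(1) by (intro powr_mono) auto
    finally show ?thesis .
  qed
  then show ?case unfolding r_def z_def .
qed

text \<open>The first stage starts from all of {1..n} with a logarithmic factor H = L / 2; the later
  ones have H = 3. In both, \<open>\<mu>\<close> balances the run against the vertices of high
  degree, leaving at most \<open>\<beta> n\<close> = O(sqrt n / L) and \<open>\<gamma> n\<close> =
  O(sqrt n / L^(3/2)) records per stage. A record costs O(L) bits, so those of the first stage cost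
  O(sqrt n), and those of the at most log L doublings together o(sqrt n).\<close>

lemma card_large_sized_family:
  fixes L :: real
  defines "\<beta> \<equiv> \<lambda>n::nat. 2 * (10 * sqrt (real n) / log 2 (real n) + 8 * log 2 (real n) ^ 3 + 1) +
    (2 * sqrt (real n) / log 2 (real n) + 1)"
  defines "\<gamma> \<equiv> \<lambda>n::nat. 2 * (48 * sqrt (real n) / (log 2 (real n))\<^sup>2 + 48 * (log 2 (real n))\<^sup>2 +
    24 * sqrt (real n) / (log 2 (real n) * sqrt (log 2 (real n))) + 1) +
    (sqrt (real n) / (log 2 (real n) * sqrt (log 2 (real n))) + 1)"
  assumes L: "L = log 2 (real n)" "1 \<le> L" and n: "2 * sqrt (real n) + 3 \<le> real n"
    and seed: "sqrt (real n) / L + 1 \<le> sqrt (real n) / sqrt L" "sqrt (real n) / L + 1 \<le> sqrt (real n)"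
    and \<beta>: "\<beta> n \<le> sqrt (real n)" and \<gamma>: "\<gamma> n \<le> sqrt (real n)"
    and m: "sqrt (real n) / sqrt L \<le> real m"
  shows "real (card (sized_family (real n / L ^ 4) m {1..n}))
    \<le> 2 powr (L * (sqrt (real n) / L + 1) + 2 * L * \<beta> n + 56 * sqrt (real n) + 2 * L * \<gamma> n * log 2 L)"
proof -
  define r where "r = sqrt (real n)"
  \<comment> \<open>This is L^(3/2). For \<mu> = 1 / (r q) the cutoff contributes 24 r / q to the
    run, and r q / L^3 = r / q bounds the number of vertices of high degree.\<close>
  define q where "q = L * sqrt L"
  have n0: "3 \<le> real n" using n by (smt (verit) real_sqrt_ge_zero of_nat_0_le_iff)
  have r: "0 < r" "real n = r\<^sup>2" using n0 unfolding r_def by auto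
  have q0: "0 < q" using L(2) unfolding q_def by simp
  have q2: "q * q = L ^ 3" using L(2) unfolding q_def by (simp add: power3_eq_cube)
  have nat_ceil: "x \<le> real (nat \<lceil>x\<rceil>)" "real (nat \<lceil>x\<rceil>) \<le> x + 1" if "0 \<le> x" for x :: real
    using that by linarith+
  define s where "s = nat \<lceil>r / L\<rceil>"
  have s: "r / L \<le> real s" "real s \<le> r / L + 1"
    unfolding s_def using r L(2) by (auto intro!: nat_ceil)
  have s0: "0 < real s" using s(1) r L(2) by (smt (verit) divide_pos_pos)
  have sm: "s \<le> m" and sr: "real s \<le> r" using s(2) seed m unfolding r_def by linarith+
  define \<kappa>1 where "\<kappa>1 = nat \<lceil>10 * r / L + 8 * L ^ 3\<rceil>"
  define b1 where "b1 = nat \<lceil>2 * r / L\<rceil>"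
  define \<kappa>2 where "\<kappa>2 = nat \<lceil>48 * r / L\<^sup>2 + 48 * L\<^sup>2 + 24 * r / q\<rceil>"
  define b2 where "b2 = nat \<lceil>r / q\<rceil>"
  have \<kappa>1: "10 * r / L + 8 * L ^ 3 \<le> real \<kappa>1" "real \<kappa>1 \<le> 10 * r / L + 8 * L ^ 3 + 1"
    unfolding \<kappa>1_def using r L(2) by (auto intro!: nat_ceil)
  have b1: "2 * r / L \<le> real b1" "real b1 \<le> 2 * r / L + 1"
    unfolding b1_def using r L(2) by (auto intro!: nat_ceil)
  have \<kappa>2: "48 * r / L\<^sup>2 + 48 * L\<^sup>2 + 24 * r / q \<le> real \<kappa>2"
    "real \<kappa>2 \<le> 48 * r / L\<^sup>2 + 48 * L\<^sup>2 + 24 * r / q + 1"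
    unfolding \<kappa>2_def using r q0 by (auto intro!: nat_ceil)
  have b2: "r / q \<le> real b2" "real b2 \<le> r / q + 1"
    unfolding b2_def using r q0 by (auto intro!: nat_ceil)
  have le\<beta>: "2 * real \<kappa>1 + real b1 \<le> \<beta> n"
    using \<kappa>1(2) b1(2) unfolding \<beta>_def L(1)[symmetric] r_def by (intro add_mono mult_left_mono) auto
  have le\<gamma>: "2 * real \<kappa>2 + real b2 \<le> \<gamma> n"
    using \<kappa>2(2) b2(2) unfolding \<gamma>_def L(1)[symmetric] r_def q_def by (intro add_mono mult_left_mono) auto
  define X where "X = 2 powr (56 * r + 2 * L * \<gamma> n * log 2 L)"
  have \<gamma>0: "0 \<le> 2 * L * \<gamma> n" using le\<gamma> L(2) by (smt (verit) mult_nonneg_nonneg of_nat_0_le_iff)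
  have later: "real (card (sized_family (real n / L ^ 4) m C)) \<le> X"
    if C: "C \<subseteq> {1..n}" "real (card C) \<le> 6 * real n / real s" for C
  proof -
    have "real (card (sized_family (real n / L ^ 4) m C))
      \<le> 2 powr (56 * sqrt (real n) - 40 * sqrt (real s * sqrt (real n)) + 2 * L * \<gamma> n * log 2 (sqrt (real n) / real s))"
    proof (rule card_sized_family_iterate[where \<mu> = "1 / (r * q)" and \<kappa> = \<kappa>2 and b = b2, OF L n m])
      have "(16 * r / L\<^sup>2 + 16 * L\<^sup>2 + 8 * real n * (1 / (r * q))) * 3 = 48 * r / L\<^sup>2 + 48 * L\<^sup>2 + 24 * r / q"
        unfolding r(2) using r(1) q0 by (simp add: power2_eq_square)
      then show "(16 * sqrt (real n) / L\<^sup>2 + 16 * L\<^sup>2 + 8 * real n * (1 / (r * q))) * 3 \<le> real \<kappa>2"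
        using \<kappa>2(1) unfolding r_def by linarith
      show "1 / (L ^ 3 * (1 / (r * q))) \<le> real b2" using b2(1) q0 unfolding q2[symmetric] by simp
      show "2 * L * (2 * real \<kappa>2 + real b2) \<le> 2 * L * \<gamma> n" using le\<gamma> L(2) by (intro mult_left_mono) auto
      show "2 * real \<kappa>2 + real b2 \<le> sqrt (real n)" using le\<gamma> \<gamma> by linarith
      show "0 < 1 / (r * q)" using r(1) q0 by simp
      show "real s \<le> sqrt (real n)" "sqrt (real n) / L \<le> real s" using sr s(1) unfolding r_def by simp_all
    qed (fact sm C)+
    also have "\<dots> \<le> X" unfolding X_def
    proof (rule powr_mono)
      have "r / real s \<le> L" using s(1) s0 L(2) by (simp add: field_simps)
      then have "log 2 (r / real s) \<le> log 2 L" using r(1) s0 L(2) by simp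
      then have "2 * L * \<gamma> n * log 2 (r / real s) \<le> 2 * L * \<gamma> n * log 2 L" using \<gamma>0 by (rule mult_left_mono)
      moreover have "0 \<le> sqrt (real s * r)" using r by simp
      ultimately show "56 * sqrt (real n) - 40 * sqrt (real s * sqrt (real n)) +
          2 * L * \<gamma> n * log 2 (sqrt (real n) / real s) \<le> 56 * r + 2 * L * \<gamma> n * log 2 L"
        unfolding r_def[symmetric] by linarith
    qed simp
    finally show ?thesis .
  qed
  have "real (card (sized_family (real n / L ^ 4) m {1..n}))
    \<le> real (card {1..n} choose s) * 2 powr (2 * L * (2 * real \<kappa>1 + real b1)) * X"
  \<comment> \<open>For this \<open>\<mu>\<close> both 8 n \<mu> H and 1 / (L^3 \<mu>) equal 2 r /
    L.\<close>
  proof (rule card_sized_family_stage[where \<mu> = "1 / (2 * L\<^sup>2 * r)" and H = "L / 2", OF order_refl L n sm _ _ m])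
    \<comment> \<open>Starting from {1..n} leaves s / 4 under the logarithm; the summand 1 is
      absorbed because 2 ln 2 \<ge> 1.\<close>
    have "1 + ln (real (card {1..n}) * real s / (4 * real n)) = 1 + ln (real s) - 2 * ln 2"
      using s0 n0 ln_realpow[of 2 2] by (simp add: ln_div)
    also have "\<dots> \<le> ln (real s)" using ln2_ge_two_thirds by linarith
    also have "\<dots> \<le> ln r" using sr s0 by simp
    also have "\<dots> = ln (real n) / 2" unfolding r_def using n0 by (simp add: ln_sqrt)
    also have "\<dots> = L * ln 2 / 2" unfolding L(1) log_def by simp
    also have "\<dots> \<le> L * 1 / 2" using L(2) ln_2_less_1 by (intro divide_right_mono mult_left_mono) auto
    finally show "1 + ln (real (card {1..n}) * real s / (4 * real n)) \<le> L / 2" by simp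
    have "(16 * r / L\<^sup>2 + 16 * L\<^sup>2 + 8 * real n * (1 / (2 * L\<^sup>2 * r))) * (L / 2) = 10 * r / L + 8 * L ^ 3"
      unfolding r(2) using r(1) L(2) by (simp add: power2_eq_square power3_eq_cube field_simps)
    then show "(16 * sqrt (real n) / L\<^sup>2 + 16 * L\<^sup>2 + 8 * real n * (1 / (2 * L\<^sup>2 * r))) * (L / 2) \<le> real \<kappa>1"
      using \<kappa>1(1) unfolding r_def by linarith
    have "1 / (L ^ 3 * (1 / (2 * L\<^sup>2 * r))) = 2 * r / L"
      using L(2) r(1) by (simp add: power2_eq_square power3_eq_cube field_simps)
    then show "1 / (L ^ 3 * (1 / (2 * L\<^sup>2 * r))) \<le> real b1" using b1(1) by simp
    show "2 * real \<kappa>1 + real b1 \<le> sqrt (real n)" using le\<beta> \<beta> by linarith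
    show "real (card (sized_family (real n / L ^ 4) m C)) \<le> X"
      if "C \<subseteq> {1..n}" "real (card C) \<le> 6 * real n / real s" for C using that by (rule later)
    show "0 < 1 / (2 * L\<^sup>2 * r)" "0 \<le> L / 2" using r(1) L(2) by simp_all
    show "real s \<le> sqrt (real n)" "sqrt (real n) / L \<le> real s" using sr s(1) unfolding r_def by simp_all
    show "0 \<le> X" unfolding X_def by simp
  qed
  also have "\<dots> \<le> 2 powr (L * (r / L + 1)) * 2 powr (2 * L * \<beta> n) * X"
  proof (intro mult_mono powr_mono)
    have "real (card {1..n} choose s) \<le> real (n ^ s)"
      using binomial_le_pow[of s n] binomial_eq_0[of n s] of_nat_le_iff by (cases "s \<le> n") fastforce+
    also have "\<dots> = real n powr real s" using n0 by (simp add: powr_realpow)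
    also have "\<dots> = (2 powr L) powr real s" unfolding L(1) using n0 by simp
    also have "\<dots> = 2 powr (L * real s)" by (simp add: powr_powr)
    also have "\<dots> \<le> 2 powr (L * (r / L + 1))" using s(2) L(2) by (intro powr_mono mult_left_mono) auto
    finally show "real (card {1..n} choose s) \<le> 2 powr (L * (r / L + 1))" .
  qed (use le\<beta> L(2) in \<open>auto simp: X_def\<close>)
  also have "\<dots> = 2 powr (L * (r / L + 1) + 2 * L * \<beta> n + 56 * r + 2 * L * \<gamma> n * log 2 L)"
    unfolding X_def by (simp only: powr_add add.assoc mult.assoc)
  finally show ?thesis unfolding r_def .
qed

section \<open>Summation over all set sizes and asymptotics\<close>

theorem theorem1p1:
  shows "\<exists>n\<^sub>0. \<forall>n\<ge>n\<^sub>0.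
    real (card (sidon_family n (real n / (log 2 (real n)) ^ 4))) \<le> 2 powr (180 * sqrt (real n))"
proof -
  define \<beta> where "\<beta> n = 2 * (10 * sqrt (real n) / log 2 (real n) + 8 * log 2 (real n) ^ 3 + 1) +
    (2 * sqrt (real n) / log 2 (real n) + 1)" for n :: nat
  define \<gamma> where "\<gamma> n = 2 * (48 * sqrt (real n) / (log 2 (real n))\<^sup>2 + 48 * (log 2 (real n))\<^sup>2 +
    24 * sqrt (real n) / (log 2 (real n) * sqrt (log 2 (real n))) + 1) +
    (sqrt (real n) / (log 2 (real n) * sqrt (log 2 (real n))) + 1)" for n :: nat
  have "eventually (\<lambda>n::nat. 1 \<le> log 2 (real n)) sequentially" by real_asymp
  moreover have "eventually (\<lambda>n::nat. 2 * sqrt (real n) + 3 \<le> real n) sequentially" by real_asymp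
  moreover have "eventually (\<lambda>n::nat. sqrt (real n) / log 2 (real n) + 1
      \<le> sqrt (real n) / sqrt (log 2 (real n))) sequentially" by real_asymp
  moreover have "eventually (\<lambda>n::nat. sqrt (real n) / log 2 (real n) + 1 \<le> sqrt (real n)) sequentially"
    by real_asymp
  moreover have "eventually (\<lambda>n. \<beta> n \<le> sqrt (real n)) sequentially" unfolding \<beta>_def by real_asymp
  moreover have "eventually (\<lambda>n. \<gamma> n \<le> sqrt (real n)) sequentially" unfolding \<gamma>_def by real_asymp
  \<comment> \<open>Since \<open>\<gamma> n\<close> has order sqrt n / L^(3/2), the left side is
    O(sqrt n log L / sqrt L).\<close>
  moreover have "eventually (\<lambda>n. 2 * log 2 (real n) * \<gamma> n * log 2 (log 2 (real n)) \<le> sqrt (real n)) sequentially"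
    unfolding \<gamma>_def by real_asymp
  \<comment> \<open>The coefficients of sqrt n on the left are 1 for the first seed, 44 from 2 L
    \<beta>, and 57, in total 102; the rest is polylogarithmic.\<close>
  moreover have "eventually (\<lambda>n::nat. log 2 (real n) * (sqrt (real n) / log 2 (real n) + 1) +
      2 * log 2 (real n) * \<beta> n + 57 * sqrt (real n) + 2 * log 2 (real n) + 1 \<le> 180 * sqrt (real n)) sequentially"
    unfolding \<beta>_def by real_asymp
  ultimately have "eventually (\<lambda>n. real (card (sidon_family n (real n / (log 2 (real n)) ^ 4)))
      \<le> 2 powr (180 * sqrt (real n))) sequentially"
  proof eventually_elim
    case (elim n)
    define L where "L = log 2 (real n)"
    define r where "r = sqrt (real n)"
    define K where "K = nat \<lfloor>r / L\<rfloor>"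
    \<comment> \<open>Here 57 = 56 + 1, where the 1 absorbs the records of all later stages.\<close>
    define Y where "Y = L * (r / L + 1) + 2 * L * \<beta> n + 57 * r"
    have L1: "1 \<le> L" using elim(1) unfolding L_def .
    have n0: "3 \<le> real n" using elim(2) by (smt (verit) real_sqrt_ge_zero of_nat_0_le_iff)
    have r: "0 < r" unfolding r_def using n0 by simp
    let ?small = "{I. I \<subseteq> {1..n} \<and> card I \<le> K}"
    let ?M = "{m \<in> {0..n}. r / sqrt L \<le> real m}"
    let ?F = "\<lambda>m. sized_family (real n / L ^ 4) m {1..n}"
    have fF: "finite (?F m)" for m unfolding sized_family_def by simp
    \<comment> \<open>Serves twice: as the cost of one element of a small set, and as a bound on the
      number of possible sizes.\<close>
    have nL: "real (n + 1) \<le> 2 powr (2 * L)"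
    proof -
      have "2 powr (2 * L) = (real n)\<^sup>2"
        unfolding L_def using n0 by (simp add: powr_powr[symmetric] mult.commute[of 2] powr_numeral)
      moreover have "real n + 1 \<le> real n * real n"
        using n0 mult_mono[of 3 "real n" "real n" "real n"] by linarith
      ultimately show ?thesis by (simp add: power2_eq_square)
    qed
    have "sidon_family n (real n / L ^ 4) \<subseteq> ?small \<union> (\<Union>m\<in>?M. ?F m)"
    proof
      fix I assume I: "I \<in> sidon_family n (real n / L ^ 4)"
      then have sub: "I \<subseteq> {1..n}" and t: "real (card (sidon_tuples I)) \<le> real n / L ^ 4"
        and size: "real (card I) \<le> r / L \<or> r / sqrt L \<le> real (card I)"
        unfolding sidon_family_def generalized_sidon_def L_def r_def by auto
      have "card I \<le> n" using card_mono[OF _ sub] by simp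
      moreover have "card I \<le> K" if "real (card I) \<le> r / L"
        using that unfolding K_def by (simp add: le_nat_floor)
      ultimately show "I \<in> ?small \<union> (\<Union>m\<in>?M. ?F m)"
        using size sub t by (auto simp: sized_family_def)
    qed
    then have "card (sidon_family n (real n / L ^ 4)) \<le> card (?small \<union> (\<Union>m\<in>?M. ?F m))"
      using fF by (intro card_mono) auto
    also have "\<dots> \<le> card ?small + (\<Sum>m\<in>?M. card (?F m))"
      by (intro order_trans[OF card_Un_le] add_left_mono card_UN_le) simp
    finally have "real (card (sidon_family n (real n / L ^ 4))) \<le> real (card ?small + (\<Sum>m\<in>?M. card (?F m)))"
      by (simp only: of_nat_le_iff)
    then have "real (card (sidon_family n (real n / L ^ 4))) \<le> real (card ?small) + (\<Sum>m\<in>?M. real (card (?F m)))"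
      by (simp only: of_nat_add of_nat_sum)
    also have "\<dots> \<le> 2 powr (2 * r) + 2 powr (2 * L + Y)"
    proof (rule add_mono)
      have "card ?small \<le> (n + 1) ^ K" using card_subsets_card_le[of "{1..n}" K] by simp
      then have "real (card ?small) \<le> real (n + 1) ^ K" by (metis of_nat_le_iff of_nat_power)
      also have "\<dots> \<le> (2 powr (2 * L)) ^ K" using nL by (intro power_mono) auto
      also have "\<dots> = 2 powr (2 * (L * real K))" by (simp add: powr_realpow[symmetric] powr_powr mult.assoc)
      also have "\<dots> \<le> 2 powr (2 * r)"
      proof -
        have "real K \<le> r / L" unfolding K_def using r L1 by (intro of_nat_floor) auto
        then have "L * real K \<le> r" using L1 by (simp add: field_simps)
        then show ?thesis by (intro powr_mono) auto
      qed
      finally show "real (card ?small) \<le> 2 powr (2 * r)" .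
      have each: "real (card (?F m)) \<le> 2 powr Y" if m: "m \<in> ?M" for m
      proof -
        have "real (card (?F m)) \<le> 2 powr (L * (r / L + 1) + 2 * L * \<beta> n + 56 * r + 2 * L * \<gamma> n * log 2 L)"
          unfolding r_def \<beta>_def \<gamma>_def
          by (rule card_large_sized_family[OF L_def L1 elim(2)])
            (use elim m in \<open>auto simp: L_def r_def \<beta>_def \<gamma>_def\<close>)
        also have "\<dots> \<le> 2 powr Y"
          using elim(7) unfolding Y_def L_def r_def by (intro powr_mono) auto
        finally show ?thesis .
      qed
      have "(\<Sum>m\<in>?M. real (card (?F m))) \<le> real (card ?M) * 2 powr Y" using each by (rule sum_bounded_above)
      also have "card ?M \<le> card {0..n}" by (intro card_mono) auto
      then have "real (card ?M) * 2 powr Y \<le> 2 powr (2 * L) * 2 powr Y"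
        using nL by (intro mult_right_mono) auto
      finally show "(\<Sum>m\<in>?M. real (card (?F m))) \<le> 2 powr (2 * L + Y)" by (simp add: powr_add)
    qed
    also have "\<dots> \<le> 2 powr (2 * L + Y) + 2 powr (2 * L + Y)"
    proof (intro add_right_mono powr_mono)
      have "0 \<le> L * (r / L + 1)" "0 \<le> 2 * L * \<beta> n"
        using L1 r unfolding \<beta>_def L_def[symmetric] r_def[symmetric] by auto
      then show "2 * r \<le> 2 * L + Y" using r L1 unfolding Y_def by linarith
    qed simp
    also have "\<dots> = 2 powr (2 * L + Y + 1)" by (simp add: powr_add)
    also have "\<dots> \<le> 2 powr (180 * r)"
      using elim(8) unfolding Y_def L_def r_def by (intro powr_mono) auto
    finally show ?case unfolding L_def r_def .
  qed
  then show ?thesis unfolding eventually_sequentially .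
qed

end
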